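(* Let $S$ be a driftless subordinator with Laplace exponent $\phi$ such that, for some $0<\beta_1<\beta_2<1$ and constants $k_1,k_2>0$, $$k_1\kappa^{\beta_1}\le\frac{\phi(\kappa\lambda)}{\phi(\lambda)}\le k_2\kappa^{\beta_2}\quad\text{for all }\lambda>0\text{ and }\kappa\ge1,$$ and whose Lévy measure has a density $\nu(z)$ with respect to Lebesgue measure such that $t\mapsto t\nu(t)$ is non-increasing on $(0,\infty)$. Let $\bar p(r,t)$ be the associated transition density, $\mathbb P(S_r\in dt)=\bar p(r,t)\,dt$. Then, for each $L>0$, there exist constants $c_i=c_{i,L}\ge1$ $(i=1,2,3)$ such that $$\frac1{c_1t}\,r\phi(t^{-1})\le\bar p(r,t)\le\frac{c_1}t\,r\phi(t^{-1})\quad\text{for all }r,t>0\text{ with }r\phi(t^{-1})\le L$$ and $$\frac1{c_2t}\,e^{-c_3t(\phi')^{-1}(t/r)}\le\bar p(r,t)\le\frac{c_2}t\,e^{-c_3^{-1}t(\phi')^{-1}(t/r)}\quad\text{for all }r,t>0\text{ with }r\phi(t^{-1})\ge L,$$ where $(\phi')^{-1}(\lambda):=\inf\{s>0:\phi'(s)\le\lambda\}$ for $\lambda\ge0$.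
   Context: A driftless subordinator $S$ (with $S_0=0$) satisfies $\mathbb E[e^{-\lambda S_t}]=e^{-t\phi(\lambda)}$ with $\phi(\lambda)=\int_0^\infty(1-e^{-\lambda x})\nu(x)\,dx$. Under the stated hypotheses $S_r$ has, for every $r>0$, a bounded density $\bar p(r,\cdot)$ that is smooth in $t$; this version of the density is used. *)

theory Defs
  imports "HOL-Probability.Probability"
begin

locale subordinator = prob_space M for M :: "'a measure" +
  fixes S :: "real \<Rightarrow> 'a \<Rightarrow> real"
  assumes measurable_S: "0 \<le> t \<Longrightarrow> random_variable borel (S t)"
    and start_zero: "AE \<omega> in M. S 0 \<omega> = 0"
    and indep_increments:
      "\<And>(\<tau> :: nat \<Rightarrow> real) n. 0 \<le> \<tau> 0 \<Longrightarrow> mono_on {..n} \<tau> \<Longrightarrow>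
         indep_vars (\<lambda>_. borel) (\<lambda>i \<omega>. S (\<tau> (Suc i)) \<omega> - S (\<tau> i) \<omega>) {..<n}"
    and stationary_increments:
      "0 \<le> s \<Longrightarrow> s \<le> t \<Longrightarrow>
         distr M borel (\<lambda>\<omega>. S t \<omega> - S s \<omega>) = distr M borel (S (t - s))"
    and paths:
      "AE \<omega> in M. mono_on {0..} (\<lambda>t. S t \<omega>) \<and>
                     (\<forall>t\<ge>0. continuous (at_right t) (\<lambda>t. S t \<omega>))"

(* Only the values of a Levy density on (0,\<infinity>) matter, here and below. *)
definition levy_density :: "(real \<Rightarrow> real) \<Rightarrow> bool" where
  "levy_density \<nu> \<longleftrightarrow>
     (\<forall>x>0. 0 \<le> \<nu> x) \<and> set_integrable lborel {0<..} (\<lambda>x. min 1 x * \<nu> x)"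

definition laplace_exponent :: "(real \<Rightarrow> real) \<Rightarrow> real \<Rightarrow> real" where
  "laplace_exponent \<nu> l = (LBINT x:{0<..}. (1 - exp (- l * x)) * \<nu> x)"

(* The absence of a linear term b * l in the exponent says that the drift is zero. *)
locale driftless_subordinator = subordinator M S for M :: "'a measure" and S +
  fixes \<nu> :: "real \<Rightarrow> real"
  assumes levy_density: "levy_density \<nu>"
    and laplace_transform:
      "0 \<le> t \<Longrightarrow> 0 \<le> l \<Longrightarrow>
         expectation (\<lambda>\<omega>. exp (- l * S t \<omega>)) = exp (- t * laplace_exponent \<nu> l)"

definition smooth_on_pos :: "(real \<Rightarrow> real) \<Rightarrow> bool" where
  "smooth_on_pos f \<longleftrightarrow> (\<forall>k. \<forall>t>0. (deriv ^^ k) f differentiable at t)"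

(* p r is the bounded version of the density of S r that is smooth on (0,\<infinity>).  Smoothness
   makes p r t unique for t > 0; the values of p r t with t \<le> 0 are irrelevant, since the law
   of S r lives on (0,\<infinity>). *)
definition transition_density ::
  "'a measure \<Rightarrow> (real \<Rightarrow> 'a \<Rightarrow> real) \<Rightarrow> (real \<Rightarrow> real \<Rightarrow> real) \<Rightarrow> bool" where
  "transition_density M S p \<longleftrightarrow>
     (\<forall>r>0. distributed M lborel (S r) (\<lambda>t. ennreal (indicator {0<..} t * p r t)) \<and>
            (\<forall>t>0. 0 \<le> p r t) \<and> bounded (p r ` {0<..}) \<and> smooth_on_pos (p r))"

(* The generalized inverse inf {s > 0. \<phi>' s \<le> y} of \<phi>'.  For an empty set the real-valued Inf is
   a junk value instead of \<infinity>; this concerns only y \<le> 0 when \<phi> is a Laplace exponent, since then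
   \<phi>' is positive (unless \<phi> = 0) and tends to 0 at infinity. *)
definition deriv_inverse :: "(real \<Rightarrow> real) \<Rightarrow> real \<Rightarrow> real" where
  "deriv_inverse \<phi> y = Inf {s. 0 < s \<and> deriv \<phi> s \<le> y}"

end

theory Submission
  imports Defs
begin

text \<open>
  Put \<open>k x = x * \<nu> x\<close> and let \<open>\<psi> = \<phi>'\<close> be the Laplace transform of \<open>k\<close>.  Differentiating the Laplace
  transform \<open>exp (- r * \<phi> l)\<close> of \<open>p r\<close> gives the renewal-type identity
  \<open>t * p r t = r * (\<integral> k s * p r (t - s) ds)\<close> over \<open>0 < s < t\<close>.

  Since \<open>k\<close> is non-increasing, the identity yields \<open>t * p r t \<ge> r * k t * P(S r < t)\<close>, and splitting it at \<open>a\<close>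
  bounds \<open>t * p r t\<close> by \<open>r * k a * P(S r < t)\<close> plus \<open>r * (\<integral> k ds)\<close> over \<open>0 < s < a\<close> times the supremum of
  \<open>p r\<close> to the left of \<open>t\<close>.  With \<open>\<mu>\<close> the point where \<open>\<psi> \<mu> = t / r\<close>, choosing \<open>a\<close> a small multiple of
  \<open>1 / \<mu>\<close> (and at most \<open>t / 2\<close>) makes the second term at most half of the supremum of \<open>s * p r s\<close> over
  \<open>0 < s \<le> t\<close>, so it can be absorbed.  By scaling, \<open>k t\<close> is comparable to \<open>\<phi> (1 / t)\<close>, and \<open>P(S r < t)\<close> is
  controlled from above by a Chernoff bound at \<open>\<mu>\<close> and from below by cutting \<open>S r\<close> into about \<open>t * \<mu>\<close>
  independent increments, each of which stays below its share of \<open>t\<close> with probability at least \<open>1 / 2\<close>.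
\<close>

section \<open>Uniqueness and convolution for Laplace transforms of nonnegative functions\<close>

section \<open>Laplace transforms\<close>

text \<open>On \<open>[0, 1]\<close> all moments are at most 1, so the Taylor polynomials of the
  characteristic function, whose coefficients are the moments, converge to it. Equal moments thus
  give equal characteristic functions, and Levy's uniqueness theorem applies.\<close>

lemma real_distribution_eqI_moments:
  assumes "real_distribution M" "real_distribution N"
    and M01: "AE x in M. 0 \<le> x \<and> x \<le> 1" and N01: "AE x in N. 0 \<le> x \<and> x \<le> 1"
    and moments: "\<And>n. (LINT x|M. x ^ n) = (LINT x|N. x ^ n)"
  shows "M = N"
proof (rule Levy_uniqueness[OF assms(1,2)], rule ext)
  fix t
  have char_bound: "cmod (char K t - (\<Sum>k\<le>n. ((\<i> * t) ^ k / fact k) * (LINT x|K. x ^ k)))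
      \<le> 2 * \<bar>t\<bar> ^ n / fact n"
    if K: "real_distribution K" and K01: "AE x in K. 0 \<le> x \<and> x \<le> 1" for K :: "real measure" and n
  proof -
    interpret real_distribution K by (rule K)
    have le1: "AE x in K. norm (x ^ k) \<le> 1" for k
      using K01 by eventually_elim (auto simp: power_le_one)
    have int: "integrable K (\<lambda>x. x ^ k)" for k
      by (rule integrable_const_bound[OF le1]) simp
    have "(LINT x|K. \<bar>x\<bar> ^ n) \<le> (LINT x|K. 1)"
      using le1[of n] integrable_abs[OF int[of n]] by (intro integral_mono_AE) (auto simp: power_abs)
    also have "\<dots> = 1" using prob_space by simp
    finally have "2 * \<bar>t\<bar> ^ n / fact n * (LINT x|K. \<bar>x\<bar> ^ n) \<le> 2 * \<bar>t\<bar> ^ n / fact n"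
      by (intro mult_left_le) auto
    with char_approx1[of n t, OF int] show ?thesis by linarith
  qed
  \<comment> \<open>Equal moments give both characteristic functions the same Taylor polynomial, so
    4 is the sum of two remainder factors 2.\<close>
  have "cmod (char M t - char N t) \<le> 4 * (\<bar>t\<bar> ^ n / fact n)" for n
    using norm_triangle_ineq4[of "char M t - (\<Sum>k\<le>n. ((\<i> * t) ^ k / fact k) * (LINT x|M. x ^ k))"
        "char N t - (\<Sum>k\<le>n. ((\<i> * t) ^ k / fact k) * (LINT x|M. x ^ k))"]
      char_bound[OF assms(1) M01, of n] char_bound[OF assms(2) N01, of n]
    by (simp add: moments)
  moreover have "(\<lambda>n. 4 * (\<bar>t\<bar> ^ n / fact n)) \<longlonglongrightarrow> 4 * 0"
    using summable_LIMSEQ_zero[OF summable_exp[of "\<bar>t\<bar>"]]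
    by (intro tendsto_mult_left) (simp add: field_simps)
  ultimately have "cmod (char M t - char N t) \<le> 4 * 0"
    by (intro LIMSEQ_le_const[where a="cmod (char M t - char N t)"]) auto
  then show "char M t = char N t" by simp
qed

text \<open>The measure with density proportional to \<open>exp (- x) * f x\<close> is pushed to \<open>[0, 1]\<close> by \<open>x \<mapsto> exp (- x)\<close>;
  its moments are the values of the Laplace transform of \<open>f\<close> at the positive integers.\<close>

lemma laplace_transform_unique:
  fixes f g F :: "real \<Rightarrow> real"
  assumes [measurable]: "f \<in> borel_measurable borel" "g \<in> borel_measurable borel"
    and nonneg: "\<And>x. 0 \<le> f x" "\<And>x. 0 \<le> g x"
    and support: "\<And>x. x \<le> 0 \<Longrightarrow> f x = 0" "\<And>x. x \<le> 0 \<Longrightarrow> g x = 0"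
    and F: "\<And>l. 0 < l \<Longrightarrow> has_bochner_integral lborel (\<lambda>x. exp (- l * x) * f x) (F l)"
           "\<And>l. 0 < l \<Longrightarrow> has_bochner_integral lborel (\<lambda>x. exp (- l * x) * g x) (F l)"
  shows "AE x in lborel. f x = g x"
proof -
  have F0: "0 \<le> F 1"
    using has_bochner_integral_integral_eq[OF F(1)[of 1]] nonneg
    by (auto intro!: Bochner_Integration.integral_nonneg simp flip: has_bochner_integral_integral_eq[OF F(1)[of 1]])
  show ?thesis
  proof (cases "F 1 = 0")
    \<comment> \<open>Without mass there is nothing to normalise, but then both functions vanish
      almost everywhere.\<close>
    case True
    have "AE x in lborel. h x = 0"
      if "has_bochner_integral lborel (\<lambda>x. exp (- 1 * x) * h x) (F 1)" "\<And>x. 0 \<le> h x" for h :: "real \<Rightarrow> real"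
      using that True integral_nonneg_eq_0_iff_AE[of lborel "\<lambda>x. exp (- 1 * x) * h x"]
      by (auto simp: has_bochner_integral_iff)
    from this[OF F(1)] this[OF F(2)] nonneg show ?thesis by auto
  next
    case False
    with F0 have pos: "0 < F 1" by simp
    define D where "D h = density lborel (\<lambda>x. ennreal (exp (- x) * h x / F 1))" for h :: "real \<Rightarrow> real"
    define E where "E h = distr (D h) borel (\<lambda>x. exp (- x))" for h :: "real \<Rightarrow> real"
    have E: "real_distribution (E h) \<and> (AE x in E h. 0 \<le> x \<and> x \<le> 1) \<and>
        (\<forall>n. (LINT x|E h. x ^ n) = F (1 + real n) / F 1)"
      if [measurable]: "h \<in> borel_measurable borel" and h0: "\<And>x. 0 \<le> h x" and supp: "\<And>x. x \<le> 0 \<Longrightarrow> h x = 0"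
        and Fh: "\<And>l. 0 < l \<Longrightarrow> has_bochner_integral lborel (\<lambda>x. exp (- l * x) * h x) (F l)" for h
    proof (intro conjI allI)
      have "emeasure (D h) (space (D h)) = (\<integral>\<^sup>+x. ennreal (exp (- x) * h x / F 1) \<partial>lborel)"
        by (simp add: D_def emeasure_density)
      also have "\<dots> = ennreal (LBINT x. exp (- x) * h x / F 1)"
        using Fh[of 1] h0 pos by (intro nn_integral_eq_integral) (auto simp: has_bochner_integral_iff)
      also have "(LBINT x. exp (- x) * h x / F 1) = 1"
        using Fh[of 1] pos by (auto simp: has_bochner_integral_iff)
      finally interpret D: prob_space "D h" by (intro prob_spaceI) simp
      show "real_distribution (E h)"
        unfolding E_def by (intro D.real_distribution_distr) (simp add: D_def)
      have "0 \<le> x" if "0 < ennreal (exp (- x) * h x / F 1)" for x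
        using that supp[of x] by (cases "x \<le> 0") auto
      then have "AE x in D h. 0 \<le> exp (- x) \<and> exp (- x) \<le> 1"
        unfolding D_def by (subst AE_density) auto
      then show "AE x in E h. 0 \<le> x \<and> x \<le> 1"
        unfolding E_def by (subst AE_distr_iff) (auto simp: D_def)
      fix n :: nat
      have "(LINT x|E h. x ^ n) = (LINT x|D h. exp (- x) ^ n)"
        unfolding E_def by (subst integral_distr) (auto simp: D_def)
      also have "\<dots> = (LBINT x. (exp (- x) * h x / F 1) * exp (- x) ^ n)"
        unfolding D_def using h0 pos by (subst integral_real_density) auto
      also have "\<dots> = (LBINT x. exp (- (1 + real n) * x) * h x / F 1)"
        by (intro Bochner_Integration.integral_cong refl)
           (simp add: exp_of_nat_mult[symmetric] mult_exp_exp[symmetric] algebra_simps exp_add[symmetric])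
      also have "\<dots> = F (1 + real n) / F 1"
        using Fh[of "1 + real n"] by (auto simp: has_bochner_integral_iff)
      finally show "(LINT x|E h. x ^ n) = F (1 + real n) / F 1" .
    qed
    have "E f = E g"
      using E[of f] E[of g] nonneg support F by (intro real_distribution_eqI_moments) auto
    \<comment> \<open>The map \<open>- ln y\<close> inverts \<open>exp (- x)\<close>, so nothing is
      lost in passing from \<open>D h\<close> to \<open>E h\<close>.\<close>
    moreover have "distr (E h) borel (\<lambda>y. - ln y) = D h" for h
      unfolding E_def by (subst distr_distr) (auto simp: D_def comp_def distr_id2)
    ultimately have "D f = D g" by metis
    then have "AE x in lborel. ennreal (exp (- x) * f x / F 1) = ennreal (exp (- x) * g x / F 1)"
      unfolding D_def by (intro sigma_finite_measure.density_unique[OF sigma_finite_lborel]) auto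
    then show ?thesis
      using nonneg pos by (auto simp: ennreal_eq_0_iff elim!: eventually_mono)
  qed
qed

text \<open>The weight factors as \<open>exp (- l * s) * exp (- l * (t - s))\<close>, and Tonelli's
  theorem separates the two integrals. Assumption \<open>conv\<close> identifies the inner Bochner
  integral with the nonnegative integral at every \<open>t\<close>.\<close>

lemma has_bochner_integral_laplace_convolution:
  fixes f g :: "real \<Rightarrow> real"
  assumes [measurable]: "f \<in> borel_measurable borel" "g \<in> borel_measurable borel"
    and nonneg: "\<And>x. 0 \<le> f x" "\<And>x. 0 \<le> g x"
    and F: "has_bochner_integral lborel (\<lambda>x. exp (- l * x) * f x) F"
    and G: "has_bochner_integral lborel (\<lambda>x. exp (- l * x) * g x) G"
    and conv: "\<And>t. integrable lborel (\<lambda>s. f s * g (t - s))"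
  shows "has_bochner_integral lborel (\<lambda>t. exp (- l * t) * (LBINT s. f s * g (t - s))) (F * G)"
proof (rule has_bochner_integral_nn_integral)
  have F0: "0 \<le> F" "0 \<le> G"
    using F G nonneg by (auto simp: has_bochner_integral_iff intro!: integral_nonneg)
  then show "0 \<le> F * G" by simp
  have nnF: "(\<integral>\<^sup>+x. ennreal (exp (- l * x) * f x) \<partial>lborel) = ennreal F"
    using F nonneg by (auto simp: has_bochner_integral_iff nn_integral_eq_integral)
  have nnG: "(\<integral>\<^sup>+t. ennreal (exp (- l * (t - s)) * g (t - s)) \<partial>lborel) = ennreal G" for s
  proof -
    have "(\<integral>\<^sup>+t. ennreal (exp (- l * (t - s)) * g (t - s)) \<partial>lborel) =
        (\<integral>\<^sup>+x. ennreal (exp (- l * x) * g x) \<partial>lborel)"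
      by (subst (2) nn_integral_real_affine[where c=1 and t="- s"]) (auto simp: algebra_simps)
    also have "\<dots> = ennreal G"
      using G nonneg by (auto simp: has_bochner_integral_iff nn_integral_eq_integral)
    finally show ?thesis .
  qed
  have "(\<integral>\<^sup>+t. ennreal (exp (- l * t) * (LBINT s. f s * g (t - s))) \<partial>lborel) =
      (\<integral>\<^sup>+t. \<integral>\<^sup>+s. ennreal (exp (- l * s) * f s) * ennreal (exp (- l * (t - s)) * g (t - s)) \<partial>lborel \<partial>lborel)"
  proof (rule nn_integral_cong)
    fix t :: real
    have "ennreal (exp (- l * t) * (LBINT s. f s * g (t - s))) =
        ennreal (LBINT s. exp (- l * t) * (f s * g (t - s)))" by simp
    also have "\<dots> = (\<integral>\<^sup>+s. ennreal (exp (- l * t) * (f s * g (t - s))) \<partial>lborel)"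
      using conv[of t] nonneg by (intro nn_integral_eq_integral[symmetric]) auto
    also have "\<dots> = (\<integral>\<^sup>+s. ennreal (exp (- l * s) * f s) * ennreal (exp (- l * (t - s)) * g (t - s)) \<partial>lborel)"
    proof (rule nn_integral_cong)
      fix s :: real
      have "exp (- l * t) = exp (- l * s) * exp (- l * (t - s))"
        by (simp add: exp_add[symmetric] algebra_simps)
      then show "ennreal (exp (- l * t) * (f s * g (t - s))) =
          ennreal (exp (- l * s) * f s) * ennreal (exp (- l * (t - s)) * g (t - s))"
        using nonneg by (simp add: ennreal_mult[symmetric] mult_ac)
    qed
    finally show "ennreal (exp (- l * t) * (LBINT s. f s * g (t - s))) = \<dots>" .
  qed
  also have "\<dots> = (\<integral>\<^sup>+s. \<integral>\<^sup>+t. ennreal (exp (- l * s) * f s) * ennreal (exp (- l * (t - s)) * g (t - s)) \<partial>lborel \<partial>lborel)"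
    by (rule lborel_pair.Fubini') measurable
  also have "\<dots> = (\<integral>\<^sup>+s. ennreal (exp (- l * s) * f s) * ennreal G \<partial>lborel)"
    by (intro nn_integral_cong) (subst nn_integral_cmult, auto simp: nnG[simplified])
  also have "\<dots> = ennreal (F * G)"
    using F0 by (simp add: nn_integral_multc nnF[simplified] ennreal_mult)
  finally show "(\<integral>\<^sup>+t. ennreal (exp (- l * t) * (LBINT s. f s * g (t - s))) \<partial>lborel) = ennreal (F * G)" .
  show "AE t in lborel. 0 \<le> exp (- l * t) * (LBINT s. f s * g (t - s))"
    using nonneg by (intro AE_I2 mult_nonneg_nonneg Bochner_Integration.integral_nonneg) auto
qed measurable

section \<open>Monotonicity, concavity and differentiability of Laplace exponents\<close>

section \<open>Laplace exponents\<close>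

text \<open>Dominated convergence along sequences. Continuity is required only for almost every
  \<open>x\<close>, because the convolution treated later has an integrand that may jump at one
  point.\<close>

lemma isCont_integral_dominated:
  fixes h :: "real \<Rightarrow> 'a \<Rightarrow> real"
  assumes U: "open U" "t \<in> U"
    and meas: "\<And>u. u \<in> U \<Longrightarrow> h u \<in> borel_measurable M"
    and bound: "\<And>u. u \<in> U \<Longrightarrow> AE x in M. norm (h u x) \<le> w x"
    and w: "integrable M w"
    and cont: "AE x in M. isCont (\<lambda>u. h u x) t"
  shows "isCont (\<lambda>u. LINT x|M. h u x) t"
proof -
  have "((\<lambda>u. LINT x|M. h u x) \<longlongrightarrow> (LINT x|M. h t x)) (at t within U)"
    unfolding tendsto_at_iff_sequentially comp_def
  proof (intro allI impI)
    fix X :: "nat \<Rightarrow> real"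
    assume X: "\<forall>i. X i \<in> U - {t}" "X \<longlonglongrightarrow> t"
    show "(\<lambda>i. LINT x|M. h (X i) x) \<longlonglongrightarrow> (LINT x|M. h t x)"
    proof (rule integral_dominated_convergence[OF _ _ w])
      show "AE x in M. (\<lambda>i. h (X i) x) \<longlonglongrightarrow> h t x"
        using cont by eventually_elim (rule isCont_tendsto_compose[OF _ X(2)])
    qed (use X U meas bound in auto)
  qed
  then show ?thesis
    unfolding isCont_def at_within_open[OF U(2,1)] .
qed

text \<open>This is the Laplace transform of \<open>x * f x\<close>.
  \<open>DERIV_laplace_exponent\<close> identifies it with the derivative; the explicit integral
  gives inequalities before differentiability is known.\<close>

definition laplace_exponent_deriv :: "(real \<Rightarrow> real) \<Rightarrow> real \<Rightarrow> real" where
  "laplace_exponent_deriv f l = (LBINT x:{0<..}. x * exp (- l * x) * f x)"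

lemma levy_density_nonneg: "levy_density f \<Longrightarrow> 0 < x \<Longrightarrow> 0 \<le> f x"
  by (simp add: levy_density_def)

text \<open>Measurability is only implicit in the integrability of \<open>min 1 x * f x\<close>;
  dividing by the positive weight recovers it.\<close>

lemma levy_density_measurable:
  assumes "levy_density f"
  shows "(\<lambda>x. indicator {0<..} x * f x) \<in> borel_measurable borel"
proof -
  have [measurable]: "(\<lambda>x. indicator {0<..} x *\<^sub>R (min 1 x * f x)) \<in> borel_measurable borel"
    using assms unfolding levy_density_def set_integrable_def by auto
  have "(\<lambda>x. indicator {0<..} x *\<^sub>R (min 1 x * f x) / min 1 x) \<in> borel_measurable borel"
    by measurable
  also have "(\<lambda>x. indicator {0<..} x *\<^sub>R (min 1 x * f x) / min 1 x) = (\<lambda>x. indicator {0<..} x * f x)"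
    by (rule ext) (auto simp: indicator_def min_def)
  finally show ?thesis .
qed

lemma levy_density_set_integrable:
  assumes f: "levy_density f" and [measurable]: "g \<in> borel_measurable borel"
    and g: "\<And>x. 0 < x \<Longrightarrow> \<bar>g x\<bar> \<le> C * min 1 x"
  shows "set_integrable lborel {0<..} (\<lambda>x. g x * f x)"
  unfolding set_integrable_def
proof (rule Bochner_Integration.integrable_bound)
  note [measurable] = levy_density_measurable[OF f]
  have "(\<lambda>x. g x * (indicator {0<..} x * f x)) \<in> borel_measurable lborel"
    by measurable
  then show "(\<lambda>x. indicator {0<..} x *\<^sub>R (g x * f x)) \<in> borel_measurable lborel"
    by (simp add: mult_ac)
  show "integrable lborel (\<lambda>x. C * (indicator {0<..} x *\<^sub>R (min 1 x * f x)))"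
    using f unfolding levy_density_def set_integrable_def by auto
  show "AE x in lborel. norm (indicator {0<..} x *\<^sub>R (g x * f x))
      \<le> norm (C * (indicator {0<..} x *\<^sub>R (min 1 x * f x)))"
  proof (intro AE_I2)
    fix x :: real
    show "norm (indicator {0<..} x *\<^sub>R (g x * f x))
      \<le> norm (C * (indicator {0<..} x *\<^sub>R (min 1 x * f x)))"
    proof (cases "0 < x")
      case True
      have "\<bar>g x\<bar> * \<bar>f x\<bar> \<le> (C * min 1 x) * \<bar>f x\<bar>"
        using g[OF True] by (intro mult_right_mono) auto
      also have "\<dots> \<le> \<bar>C * min 1 x\<bar> * \<bar>f x\<bar>"
        by (intro mult_right_mono) auto
      also have "\<dots> = \<bar>C * (min 1 x * f x)\<bar>"
        by (simp add: abs_mult mult.assoc)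
      finally show ?thesis using True by (simp add: abs_mult)
    qed simp
  qed
qed

lemma levy_density_integrable_exponent:
  assumes f: "levy_density f" and l: "0 \<le> l"
  shows "set_integrable lborel {0<..} (\<lambda>x. (1 - exp (- l * x)) * f x)"
proof (rule levy_density_set_integrable[OF f])
  fix x :: real assume x: "0 < x"
  have "1 - exp (- l * x) \<le> l * x" using exp_ge_add_one_self[of "- l * x"] by simp
  moreover have "1 - exp (- l * x) \<le> 1" "0 \<le> 1 - exp (- l * x)" using x l by auto
  moreover have "0 \<le> l * x" using x l by simp
  ultimately show "\<bar>1 - exp (- l * x)\<bar> \<le> (1 + l) * min 1 x"
    using x l by (auto simp: min_def algebra_simps)
qed measurable

lemma mult_exp_le: "0 < l \<Longrightarrow> x * exp (- l * x) \<le> 1 / l" for x l :: real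
proof -
  assume l: "0 < l"
  have "l * x \<le> exp (l * x)" using exp_ge_add_one_self[of "l * x"] by linarith
  then show ?thesis using l by (simp add: exp_minus field_simps)
qed

lemma levy_density_integrable_deriv:
  assumes f: "levy_density f" and l: "0 < l"
  shows "set_integrable lborel {0<..} (\<lambda>x. x * exp (- l * x) * f x)"
proof (rule levy_density_set_integrable[OF f])
  fix x :: real assume x: "0 < x"
  have "x * exp (- l * x) \<le> x * 1" using x l by (intro mult_left_mono) auto
  moreover have "0 \<le> x * exp (- l * x)" using x by simp
  moreover have "0 \<le> x / l" using x l by simp
  ultimately show "\<bar>x * exp (- l * x)\<bar> \<le> (1 + 1 / l) * min 1 x"
    using mult_exp_le[OF l, of x] by (auto simp: min_def algebra_simps)
qed measurable

lemma laplace_exponent_0: "laplace_exponent f 0 = 0"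
  by (simp add: laplace_exponent_def)

lemma laplace_exponent_nonneg: "levy_density f \<Longrightarrow> 0 \<le> l \<Longrightarrow> 0 \<le> laplace_exponent f l"
  unfolding laplace_exponent_def set_lebesgue_integral_def
  by (intro Bochner_Integration.integral_nonneg) (auto simp: indicator_def levy_density_nonneg)

lemma laplace_exponent_mono:
  assumes f: "levy_density f" and l: "0 \<le> l" "l \<le> l'"
  shows "laplace_exponent f l \<le> laplace_exponent f l'"
  unfolding laplace_exponent_def
  using l by (intro set_integral_mono levy_density_integrable_exponent[OF f] mult_right_mono)
     (auto simp: levy_density_nonneg[OF f] mult_right_mono)

lemma laplace_exponent_deriv_antimono:
  assumes f: "levy_density f" and l: "0 < l" "l \<le> l'"
  shows "laplace_exponent_deriv f l' \<le> laplace_exponent_deriv f l"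
  unfolding laplace_exponent_deriv_def
  using l by (intro set_integral_mono levy_density_integrable_deriv[OF f] mult_right_mono)
     (auto simp: levy_density_nonneg[OF f] mult_right_mono)

text \<open>Integrate \<open>y * exp (- y) \<le> 1 - exp (- y)\<close> at
  \<open>y = l * x\<close>.\<close>

lemma laplace_exponent_deriv_le:
  assumes f: "levy_density f" and l: "0 < l"
  shows "l * laplace_exponent_deriv f l \<le> laplace_exponent f l"
proof -
  have "l * laplace_exponent_deriv f l = (LBINT x:{0<..}. l * (x * exp (- l * x) * f x))"
    unfolding laplace_exponent_deriv_def by simp
  also have "\<dots> \<le> laplace_exponent f l"
    unfolding laplace_exponent_def
  proof (intro set_integral_mono levy_density_integrable_exponent[OF f] set_integrable_mult_right impI
      levy_density_integrable_deriv[OF f])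
    fix x :: real assume x: "x \<in> {0<..}"
    have "(1 + l * x) * exp (- l * x) \<le> exp (l * x) * exp (- l * x)"
      using exp_ge_add_one_self[of "l * x"] by (intro mult_right_mono) auto
    then have "l * x * exp (- l * x) \<le> 1 - exp (- l * x)"
      by (simp add: exp_minus field_simps)
    then have "l * x * exp (- l * x) * f x \<le> (1 - exp (- l * x)) * f x"
      using x levy_density_nonneg[OF f] by (intro mult_right_mono) auto
    then show "l * (x * exp (- l * x) * f x) \<le> (1 - exp (- l * x)) * f x" by (simp add: mult_ac)
  qed (use l in auto)
  finally show ?thesis .
qed

text \<open>These are the tangent inequalities of a concave function. They come from
  \<open>1 + y \<le> exp y\<close> under the integral, and differentiability is then derived from
  them.\<close>

lemma laplace_exponent_increment:
  assumes f: "levy_density f" and l: "0 < l" "l \<le> l'"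
  shows "(l' - l) * laplace_exponent_deriv f l' \<le> laplace_exponent f l' - laplace_exponent f l"
    and "laplace_exponent f l' - laplace_exponent f l \<le> (l' - l) * laplace_exponent_deriv f l"
proof -
  have incr: "laplace_exponent f l' - laplace_exponent f l =
      (LBINT x:{0<..}. (1 - exp (- l' * x)) * f x - (1 - exp (- l * x)) * f x)"
    unfolding laplace_exponent_def
    using l by (intro set_integral_diff(2)[symmetric] levy_density_integrable_exponent[OF f]) auto
  have int: "set_integrable lborel {0<..} (\<lambda>x. (1 - exp (- l' * x)) * f x - (1 - exp (- l * x)) * f x)"
    using l by (intro set_integral_diff(1) levy_density_integrable_exponent[OF f]) auto
  have pw: "(l' - l) * (x * exp (- l' * x)) \<le> exp (- l * x) - exp (- l' * x)"
    "exp (- l * x) - exp (- l' * x) \<le> (l' - l) * (x * exp (- l * x))" for x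
  proof -
    have "exp (- l' * x) * (1 + (l' - l) * x) \<le> exp (- l' * x) * exp ((l' - l) * x)"
      by (intro mult_left_mono exp_ge_add_one_self) auto
    then show "(l' - l) * (x * exp (- l' * x)) \<le> exp (- l * x) - exp (- l' * x)"
      by (simp add: exp_add[symmetric] algebra_simps)
    have "exp (- l * x) * (1 + - (l' - l) * x) \<le> exp (- l * x) * exp (- (l' - l) * x)"
      by (intro mult_left_mono exp_ge_add_one_self) auto
    then show "exp (- l * x) - exp (- l' * x) \<le> (l' - l) * (x * exp (- l * x))"
      by (simp add: exp_add[symmetric] algebra_simps)
  qed
  have "(l' - l) * laplace_exponent_deriv f l' = (LBINT x:{0<..}. (l' - l) * (x * exp (- l' * x) * f x))"
    unfolding laplace_exponent_deriv_def by simp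
  also have "\<dots> \<le> laplace_exponent f l' - laplace_exponent f l"
    unfolding incr
  proof (intro set_integral_mono int set_integrable_mult_right impI levy_density_integrable_deriv[OF f])
    fix x :: real assume x: "x \<in> {0<..}"
    show "(l' - l) * (x * exp (- l' * x) * f x) \<le> (1 - exp (- l' * x)) * f x - (1 - exp (- l * x)) * f x"
      using mult_right_mono[OF pw(1)[of x], of "f x"] x levy_density_nonneg[OF f, of x]
      by (simp add: algebra_simps)
  qed (use l in auto)
  finally show "(l' - l) * laplace_exponent_deriv f l' \<le> laplace_exponent f l' - laplace_exponent f l" .
  have "laplace_exponent f l' - laplace_exponent f l \<le> (LBINT x:{0<..}. (l' - l) * (x * exp (- l * x) * f x))"
    unfolding incr
  proof (intro set_integral_mono int set_integrable_mult_right impI levy_density_integrable_deriv[OF f])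
    fix x :: real assume x: "x \<in> {0<..}"
    show "(1 - exp (- l' * x)) * f x - (1 - exp (- l * x)) * f x \<le> (l' - l) * (x * exp (- l * x) * f x)"
      using mult_right_mono[OF pw(2)[of x], of "f x"] x levy_density_nonneg[OF f, of x]
      by (simp add: algebra_simps)
  qed (use l in auto)
  also have "\<dots> = (l' - l) * laplace_exponent_deriv f l"
    unfolding laplace_exponent_deriv_def by simp
  finally show "laplace_exponent f l' - laplace_exponent f l \<le> (l' - l) * laplace_exponent_deriv f l" .
qed

lemma isCont_laplace_exponent_deriv:
  assumes f: "levy_density f" and l: "0 < l"
  shows "isCont (laplace_exponent_deriv f) l"
  unfolding laplace_exponent_deriv_def set_lebesgue_integral_def
proof (rule isCont_integral_dominated[where U="{l / 2<..}"])
  show "integrable lborel (\<lambda>x. indicator {0<..} x *\<^sub>R (x * exp (- (l / 2) * x) * f x))"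
    using levy_density_integrable_deriv[OF f, of "l / 2"] l unfolding set_integrable_def by simp
  fix u assume u: "u \<in> {l / 2<..}"
  then have "0 < u" using l by simp
  show "(\<lambda>x. indicator {0<..} x *\<^sub>R (x * exp (- u * x) * f x)) \<in> borel_measurable lborel"
    using levy_density_integrable_deriv[OF f \<open>0 < u\<close>] unfolding set_integrable_def by auto
  show "AE x in lborel. norm (indicator {0<..} x *\<^sub>R (x * exp (- u * x) * f x))
      \<le> indicator {0<..} x *\<^sub>R (x * exp (- (l / 2) * x) * f x)"
    using u by (intro AE_I2)
      (auto simp: indicator_def abs_mult levy_density_nonneg[OF f] intro!: mult_right_mono mult_left_mono)
next
  show "AE x in lborel. isCont (\<lambda>u. indicator {0<..} x *\<^sub>R (x * exp (- u * x) * f x)) l"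
    by (intro AE_I2 continuous_intros)
qed (use l in auto)

text \<open>The increment bounds trap the difference quotient between the values of the candidate
  derivative at \<open>l\<close> and \<open>l + h\<close>; continuity of the candidate finishes the
  argument.\<close>

lemma DERIV_laplace_exponent:
  assumes f: "levy_density f" and l: "0 < l"
  shows "(laplace_exponent f has_real_derivative laplace_exponent_deriv f l) (at l)"
  unfolding DERIV_def
proof -
  let ?\<phi> = "laplace_exponent f" and ?\<psi> = "laplace_exponent_deriv f"
  have "(\<lambda>h. ?\<psi> (l + h) - ?\<psi> l) \<midarrow>0\<rightarrow> 0"
    using isCont_laplace_exponent_deriv[OF assms] by (simp add: isCont_iff LIM_zero)
  moreover have "eventually (\<lambda>h. norm ((?\<phi> (l + h) - ?\<phi> l) / h - ?\<psi> l) \<le> \<bar>?\<psi> (l + h) - ?\<psi> l\<bar>) (at 0)"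
    unfolding eventually_at
  proof (intro exI[of _ l] conjI ballI impI)
    fix h :: real assume h: "h \<noteq> 0 \<and> dist h 0 < l"
    show "norm ((?\<phi> (l + h) - ?\<phi> l) / h - ?\<psi> l) \<le> \<bar>?\<psi> (l + h) - ?\<psi> l\<bar>"
    proof (cases "0 < h")
      case True
      then have "?\<psi> (l + h) \<le> (?\<phi> (l + h) - ?\<phi> l) / h" "(?\<phi> (l + h) - ?\<phi> l) / h \<le> ?\<psi> l"
        using laplace_exponent_increment[OF f l, of "l + h"] by (auto simp: field_simps)
      then show ?thesis by auto
    next
      case False
      then have "h < 0" "0 < l + h" using h by auto
      then have "?\<psi> l \<le> (?\<phi> (l + h) - ?\<phi> l) / h" "(?\<phi> (l + h) - ?\<phi> l) / h \<le> ?\<psi> (l + h)"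
        using laplace_exponent_increment[OF f, of "l + h" l] by (auto simp: field_simps)
      then show ?thesis by auto
    qed
  qed (rule l)
  ultimately have "(\<lambda>h. (?\<phi> (l + h) - ?\<phi> l) / h - ?\<psi> l) \<midarrow>0\<rightarrow> 0"
    by (rule Lim_null_comparison[rotated, OF tendsto_rabs_zero])
  then show "(\<lambda>h. (?\<phi> (l + h) - ?\<phi> l) / h) \<midarrow>0\<rightarrow> ?\<psi> l"
    by (rule LIM_zero_cancel)
qed

section \<open>Consequences of the scaling condition for \<open>\<phi>\<close> and
  \<open>\<psi>\<close>\<close>

section \<open>Scaling\<close>

lemma has_bochner_integral_exp_Ioi:
  assumes l: "(0::real) < l"
  shows "has_bochner_integral lborel (\<lambda>x. indicator {0<..} x * exp (- l * x)) (1 / l)"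
proof -
  have "has_bochner_integral lborel (\<lambda>x::real. x ^ 0 * exp (- x) * indicator {0<..} x) (fact 0)"
    by (rule has_bochner_integral_I0i_power_exp_m)
  then have "has_bochner_integral lborel (\<lambda>x::real. (0 + l * x) ^ 0 * exp (- (0 + l * x)) * indicator {0<..} (0 + l * x)) (fact 0 /\<^sub>R \<bar>l\<bar>)"
    using l by (subst (asm) lborel_has_bochner_integral_real_affine_iff[where c=l and t=0]) auto
  also have "(\<lambda>x::real. (0 + l * x) ^ 0 * exp (- (0 + l * x)) * indicator {0<..} (0 + l * x)) =
      (\<lambda>x. indicator {0<..} x * exp (- l * x))"
    using l by (auto simp: indicator_def zero_less_mult_iff)
  finally show ?thesis using l by (simp add: divide_inverse)
qed

lemma powr_small:
  assumes "(0::real) < b" "0 < \<epsilon>"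
  obtains \<delta> :: real where "0 < \<delta>" "\<delta> < 1" "\<delta> powr b \<le> \<epsilon>"
proof
  let ?d = "min (1 / 2) (\<epsilon> powr (1 / b))"
  show "0 < ?d" "?d < 1" using assms by auto
  have "?d powr b \<le> (\<epsilon> powr (1 / b)) powr b"
    using assms by (intro powr_mono2) auto
  then show "?d powr b \<le> \<epsilon>" using assms by (simp add: powr_powr)
qed

locale scaling_levy_density =
  fixes \<nu> :: "real \<Rightarrow> real" and \<beta>\<^sub>1 \<beta>\<^sub>2 k\<^sub>1 k\<^sub>2 :: real
  assumes levy: "levy_density \<nu>"
    and params: "0 < \<beta>\<^sub>1" "\<beta>\<^sub>2 < 1" "0 < k\<^sub>1" "0 < k\<^sub>2"
    and scaling: "\<And>l \<kappa>. 0 < l \<Longrightarrow> 1 \<le> \<kappa> \<Longrightarrow>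
           k\<^sub>1 * \<kappa> powr \<beta>\<^sub>1 \<le> laplace_exponent \<nu> (\<kappa> * l) / laplace_exponent \<nu> l \<and>
           laplace_exponent \<nu> (\<kappa> * l) / laplace_exponent \<nu> l \<le> k\<^sub>2 * \<kappa> powr \<beta>\<^sub>2"
    and antimono: "antimono_on {0<..} (\<lambda>t. t * \<nu> t)"
begin

abbreviation \<phi> :: "real \<Rightarrow> real" where "\<phi> \<equiv> laplace_exponent \<nu>"
abbreviation \<psi> :: "real \<Rightarrow> real" where "\<psi> \<equiv> laplace_exponent_deriv \<nu>"
abbreviation K :: "real \<Rightarrow> real" where "K t \<equiv> t * \<nu> t"

lemma phi_pos: assumes "0 < l" shows "0 < \<phi> l"
proof -
  \<comment> \<open>If \<open>\<phi> l\<close> were 0, the quotient would be 0 by the convention for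
    division by zero, contradicting \<open>0 < k\<^sub>1\<close>.\<close>
  have "k\<^sub>1 \<le> \<phi> l / \<phi> l" using scaling[OF assms, of 1] by simp
  then have "\<phi> l \<noteq> 0" using params by auto
  then show ?thesis using laplace_exponent_nonneg[OF levy, of l] assms by simp
qed

lemma phi_scaling:
  assumes "0 < l" "1 \<le> \<kappa>"
  shows "k\<^sub>1 * \<kappa> powr \<beta>\<^sub>1 * \<phi> l \<le> \<phi> (\<kappa> * l)" "\<phi> (\<kappa> * l) \<le> k\<^sub>2 * \<kappa> powr \<beta>\<^sub>2 * \<phi> l"
  using scaling[OF assms] phi_pos[OF assms(1)] by (auto simp: field_simps)

text \<open>A converse to \<open>laplace_exponent_deriv_le\<close>. The lower scaling bound gives a
  \<open>\<kappa>\<close> with \<open>\<phi> (\<kappa> * l)\<close> at least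
  \<open>2 * \<phi> l\<close>, while by concavity the increment is at most
  \<open>(\<kappa> - 1) * l * \<psi> l\<close>.\<close>

lemma phi_le_psi: obtains C where "1 \<le> C" "\<And>l. 0 < l \<Longrightarrow> \<phi> l \<le> C * (l * \<psi> l)"
proof -
  define \<kappa> where "\<kappa> = max 2 ((2 / k\<^sub>1) powr (1 / \<beta>\<^sub>1))"
  have \<kappa>: "2 \<le> \<kappa>" "(2 / k\<^sub>1) powr (1 / \<beta>\<^sub>1) \<le> \<kappa>" by (auto simp: \<kappa>_def)
  have "\<phi> l \<le> (\<kappa> - 1) * (l * \<psi> l)" if l: "0 < l" for l
  proof -
  have "2 / k\<^sub>1 = ((2 / k\<^sub>1) powr (1 / \<beta>\<^sub>1)) powr \<beta>\<^sub>1"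
    using params by (simp add: powr_powr)
  also have "\<dots> \<le> \<kappa> powr \<beta>\<^sub>1" using params \<kappa> by (intro powr_mono2) auto
  finally have "2 \<le> k\<^sub>1 * \<kappa> powr \<beta>\<^sub>1" using params by (simp add: field_simps)
  then have "2 * \<phi> l \<le> k\<^sub>1 * \<kappa> powr \<beta>\<^sub>1 * \<phi> l"
    using phi_pos[OF l] by (intro mult_right_mono) auto
  also have "\<dots> \<le> \<phi> (\<kappa> * l)" using l \<kappa> by (intro phi_scaling) auto
  also have "\<dots> \<le> \<phi> l + (\<kappa> * l - l) * \<psi> l"
    using laplace_exponent_increment(2)[OF levy l, of "\<kappa> * l"] l \<kappa> by simp
  finally show ?thesis by (simp add: algebra_simps)
  qed
  with \<kappa> show thesis by (intro that[of "\<kappa> - 1"]) auto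
qed

lemma psi_pos: assumes "0 < l" shows "0 < \<psi> l"
proof -
  obtain C where C: "1 \<le> C" "\<And>l. 0 < l \<Longrightarrow> \<phi> l \<le> C * (l * \<psi> l)"
    using phi_le_psi by blast
  have "0 < C * (l * \<psi> l)" using C(2)[OF assms] phi_pos[OF assms] by linarith
  then show ?thesis using C(1) assms by (auto simp: zero_less_mult_iff)
qed

text \<open>Quantitative strict concavity, which makes the Chernoff exponent proportional to
  \<open>\<phi>\<close>. For a linear exponent the gap would be 0; upper scaling with a power below
  1 excludes this.\<close>

lemma phi_psi_gap: obtains \<eta> where "0 < \<eta>" "\<And>l. 0 < l \<Longrightarrow> \<eta> * \<phi> l \<le> \<phi> l - l * \<psi> l"
proof -
  obtain \<delta> where \<delta>: "0 < \<delta>" "\<delta> < 1" "\<delta> powr (1 - \<beta>\<^sub>2) \<le> 1 / (2 * k\<^sub>2)"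
    using params powr_small[of "1 - \<beta>\<^sub>2" "1 / (2 * k\<^sub>2)"] by auto
  \<comment> \<open>Upper scaling will give \<open>q * \<phi> l \<le> \<phi> (\<delta> * l)\<close>.
    The choice of \<open>\<delta>\<close> makes \<open>q\<close> at least
    \<open>2 * \<delta>\<close>, so \<open>\<phi>\<close> shrinks by less than the linear factor
    \<open>\<delta>\<close>.\<close>
  define q where "q = \<delta> powr \<beta>\<^sub>2 / k\<^sub>2"
  have "\<delta> = \<delta> powr \<beta>\<^sub>2 * \<delta> powr (1 - \<beta>\<^sub>2)" using \<delta> by (simp add: powr_add[symmetric])
  also have "\<dots> \<le> \<delta> powr \<beta>\<^sub>2 * (1 / (2 * k\<^sub>2))" using \<delta> by (intro mult_left_mono) auto
  also have "\<dots> = q / 2" by (simp add: q_def)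
  finally have q: "\<delta> < q" using \<delta> by linarith
  show ?thesis
  proof
    show "0 < (q - \<delta>) / (1 - \<delta>)" using q \<delta> by simp
    fix l :: real assume l: "0 < l"
    have "\<phi> (1 / \<delta> * (\<delta> * l)) \<le> k\<^sub>2 * (1 / \<delta>) powr \<beta>\<^sub>2 * \<phi> (\<delta> * l)"
      using l \<delta> by (intro phi_scaling) auto
    then have "q * \<phi> l \<le> \<phi> (\<delta> * l)"
      using \<delta> params by (simp add: q_def powr_divide field_simps)
    moreover have "(l - \<delta> * l) * \<psi> l \<le> \<phi> l - \<phi> (\<delta> * l)"
      using l \<delta> by (intro laplace_exponent_increment[OF levy]) auto
    ultimately have "(1 - \<delta>) * (l * \<psi> l) \<le> (1 - q) * \<phi> l" by (simp add: algebra_simps)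
    then have "l * \<psi> l \<le> (1 - q) / (1 - \<delta>) * \<phi> l" using \<delta> by (simp add: field_simps)
    moreover have "(q - \<delta>) / (1 - \<delta>) = 1 - (1 - q) / (1 - \<delta>)" using \<delta> by (simp add: field_simps)
    ultimately show "(q - \<delta>) / (1 - \<delta>) * \<phi> l \<le> \<phi> l - l * \<psi> l" by (simp add: left_diff_distrib)
  qed
qed

text \<open>\<open>\<psi> (l / \<delta>)\<close> is at most
  \<open>\<delta> / l * \<phi> (l / \<delta>)\<close>, and upper scaling turns this into
  \<open>\<delta> powr (1 - \<beta>\<^sub>2)\<close> times a multiple of \<open>\<psi> l\<close>.
  This is the source of every small factor used for absorption below.\<close>

lemma psi_decay:
  assumes "0 < \<epsilon>"
  obtains \<delta> where "0 < \<delta>" "\<delta> < 1" "\<And>l. 0 < l \<Longrightarrow> \<psi> (l / \<delta>) \<le> \<epsilon> * \<psi> l"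
proof -
  obtain C where C: "1 \<le> C" "\<And>l. 0 < l \<Longrightarrow> \<phi> l \<le> C * (l * \<psi> l)"
    using phi_le_psi by blast
  obtain \<delta> where \<delta>: "0 < \<delta>" "\<delta> < 1" "\<delta> powr (1 - \<beta>\<^sub>2) \<le> \<epsilon> / (k\<^sub>2 * C)"
    using params C assms powr_small[of "1 - \<beta>\<^sub>2" "\<epsilon> / (k\<^sub>2 * C)"] by auto
  have "\<psi> (l / \<delta>) \<le> \<epsilon> * \<psi> l" if l: "0 < l" for l
  proof -
    have "l * \<psi> (l / \<delta>) \<le> \<delta> * \<phi> (1 / \<delta> * l)"
      using laplace_exponent_deriv_le[OF levy, of "l / \<delta>"] l \<delta> by (simp add: field_simps)
    also have "\<dots> \<le> \<delta> * (k\<^sub>2 * (1 / \<delta>) powr \<beta>\<^sub>2 * \<phi> l)"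
      using \<delta> l by (intro mult_left_mono phi_scaling) auto
    also have "\<dots> = k\<^sub>2 * \<delta> powr (1 - \<beta>\<^sub>2) * \<phi> l"
      using \<delta> by (simp add: powr_diff powr_divide)
    also have "\<dots> \<le> k\<^sub>2 * (\<epsilon> / (k\<^sub>2 * C)) * \<phi> l"
      using \<delta> params phi_pos[OF l] by (intro mult_right_mono mult_left_mono) auto
    also have "\<dots> \<le> k\<^sub>2 * (\<epsilon> / (k\<^sub>2 * C)) * (C * (l * \<psi> l))"
      using assms params C l by (intro mult_left_mono) auto
    also have "\<dots> = l * (\<epsilon> * \<psi> l)" using params C by simp
    finally show ?thesis using l by simp
  qed
  with \<delta> show thesis by (intro that)
qed

section \<open>Comparison of \<open>K\<close> with \<open>\<phi>\<close> and
  \<open>\<psi>\<close>\<close>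

lemma K_nonneg: "0 < t \<Longrightarrow> 0 \<le> K t"
  using levy_density_nonneg[OF levy] by simp

lemma K_antimono: "0 < s \<Longrightarrow> s \<le> t \<Longrightarrow> K t \<le> K s"
  using antimono by (auto simp: monotone_on_def)

lemma K_set_integrable: assumes "0 < a" shows "set_integrable lborel {0<..<a} K"
proof -
  have "set_integrable lborel {0<..} (\<lambda>x. (indicator {..<a} x * x) * \<nu> x)"
    using assms by (intro levy_density_set_integrable[OF levy, where C="1 + a"])
      (auto simp: indicator_def min_def algebra_simps)
  also have "?this \<longleftrightarrow> ?thesis"
    unfolding set_integrable_def
    by (intro Bochner_Integration.integrable_cong) (auto simp: indicator_def)
  finally show ?thesis .
qed

text \<open>On \<open>0 < x < a\<close> the weight \<open>exp (1 - x / a)\<close> is at least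
  1.\<close>

lemma integral_K_le: assumes a: "0 < a" shows "(LBINT x:{0<..<a}. K x) \<le> exp 1 * \<psi> (1 / a)"
proof -
  have "exp 1 * \<psi> (1 / a) = (LBINT x:{0<..}. exp 1 * (x * exp (- (1 / a) * x) * \<nu> x))"
    unfolding laplace_exponent_deriv_def by simp
  moreover have "(LBINT x:{0<..<a}. K x) \<le> (LBINT x:{0<..}. exp 1 * (x * exp (- (1 / a) * x) * \<nu> x))"
    unfolding set_lebesgue_integral_def
  proof (intro integral_mono)
    show "integrable lborel (\<lambda>x. indicator {0<..<a} x *\<^sub>R K x)"
      using K_set_integrable[OF a] unfolding set_integrable_def .
    have "set_integrable lborel {0<..} (\<lambda>x. exp 1 * (x * exp (- (1 / a) * x) * \<nu> x))"
      using a by (intro set_integrable_mult_right impI levy_density_integrable_deriv[OF levy]) auto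
    then show "integrable lborel (\<lambda>x. indicator {0<..} x *\<^sub>R (exp 1 * (x * exp (- (1 / a) * x) * \<nu> x)))"
      unfolding set_integrable_def .
    fix x :: real
    show "indicator {0<..<a} x *\<^sub>R K x \<le> indicator {0<..} x *\<^sub>R (exp 1 * (x * exp (- (1 / a) * x) * \<nu> x))"
    proof (cases "x \<in> {0<..<a}")
      case True
      then have "1 * K x \<le> exp (1 - x / a) * K x"
        using K_nonneg[of x] by (intro mult_right_mono) auto
      also have "\<dots> = exp 1 * (x * exp (- (1 / a) * x) * \<nu> x)"
        by (simp add: exp_diff exp_minus field_simps)
      finally show ?thesis using True by simp
    qed (use levy_density_nonneg[OF levy] in \<open>auto simp: indicator_def\<close>)
  qed
  ultimately show ?thesis by simp
qed

text \<open>By monotonicity \<open>t * K t\<close> is at most the integral of \<open>K\<close> over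
  \<open>(0, t)\<close>.\<close>

lemma K_le: assumes t: "0 < t" shows "K t \<le> exp 1 * \<phi> (1 / t)"
proof -
  have "t * K t = (LBINT x:{0<..<t}. K t)"
    using t by (simp add: set_lebesgue_integral_def)
  also have "\<dots> \<le> (LBINT x:{0<..<t}. K x)"
    using t by (intro set_integral_mono K_set_integrable K_antimono) (auto simp: set_integrable_def)
  also have "\<dots> \<le> exp 1 * \<psi> (1 / t)" by (rule integral_K_le[OF t])
  also have "\<dots> \<le> t * (exp 1 * \<phi> (1 / t))"
    using laplace_exponent_deriv_le[OF levy, of "1 / t"] t by (simp add: field_simps)
  finally show ?thesis using t by simp
qed

text \<open>Split the integral defining \<open>\<psi> l\<close> at \<open>a\<close>: below
  \<open>a\<close> drop the exponential, above it replace \<open>K\<close> by \<open>K a\<close> and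
  enlarge the domain to all of \<open>(0, \<infinity>)\<close>.\<close>

lemma psi_le_integral_K:
  assumes l: "0 < l" and a: "0 < a"
  shows "\<psi> l \<le> (LBINT x:{0<..<a}. K x) + K a / l"
proof -
  have 1: "integrable lborel (\<lambda>x. indicator {0<..<a} x * K x)"
    using K_set_integrable[OF a] unfolding set_integrable_def by simp
  have 2: "has_bochner_integral lborel (\<lambda>x. K a * (indicator {0<..} x * exp (- l * x))) (K a * (1 / l))"
    by (intro has_bochner_integral_mult_right has_bochner_integral_exp_Ioi l)
  have "\<psi> l \<le> (LBINT x. indicator {0<..<a} x * K x + K a * (indicator {0<..} x * exp (- l * x)))"
    unfolding laplace_exponent_deriv_def set_lebesgue_integral_def
  proof (intro integral_mono)
    show "integrable lborel (\<lambda>x. indicator {0<..} x *\<^sub>R (x * exp (- l * x) * \<nu> x))"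
      using levy_density_integrable_deriv[OF levy l] unfolding set_integrable_def .
    show "integrable lborel (\<lambda>x. indicator {0<..<a} x * K x + K a * (indicator {0<..} x * exp (- l * x)))"
      using 1 2 by (intro Bochner_Integration.integrable_add) (auto simp: has_bochner_integral_iff)
    fix x :: real
    have K: "0 \<le> K a * exp (- l * x)" using K_nonneg[OF a] by auto
    consider "x \<le> 0" | "0 < x" "x < a" | "a \<le> x" by linarith
    then show "indicator {0<..} x *\<^sub>R (x * exp (- l * x) * \<nu> x) \<le>
        indicator {0<..<a} x * K x + K a * (indicator {0<..} x * exp (- l * x))"
    proof cases
      case 2
      have "exp (- l * x) * K x \<le> K x"
        using 2 l K_nonneg[of x] by (intro mult_left_le_one_le) auto
      then have "exp (- l * x) * K x + 0 \<le> K x + K a * exp (- l * x)"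
        using K by (intro add_mono)
      then show ?thesis using 2 by (simp add: mult_ac)
    next
      case 3
      then have "exp (- l * x) * K x \<le> exp (- l * x) * K a"
        using a K_antimono[of a x] by (intro mult_left_mono) auto
      then show ?thesis using 3 a by (simp add: mult_ac)
    qed simp
  qed
  also have "\<dots> = (LBINT x:{0<..<a}. K x) + K a / l"
    using 1 2 by (subst Bochner_Integration.integral_add)
      (auto simp: has_bochner_integral_iff set_lebesgue_integral_def)
  finally show ?thesis .
qed

text \<open>Apply \<open>psi_le_integral_K\<close> at \<open>l = \<delta> / t\<close> and
  \<open>a = t\<close>. The factor \<open>1 / (2 * exp 1)\<close> from \<open>psi_decay\<close>
  makes the head at most half of \<open>\<psi> (\<delta> / t)\<close>, so \<open>K t\<close> must
  carry the other half; scaling then returns from \<open>\<delta> / t\<close> to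
  \<open>1 / t\<close>.\<close>

lemma K_ge: obtains c where "0 < c" "\<And>t. 0 < t \<Longrightarrow> c * \<phi> (1 / t) \<le> K t"
proof -
  obtain C where C: "1 \<le> C" "\<And>l. 0 < l \<Longrightarrow> \<phi> l \<le> C * (l * \<psi> l)"
    using phi_le_psi by blast
  obtain \<delta> where \<delta>: "0 < \<delta>" "\<delta> < 1" "\<And>l. 0 < l \<Longrightarrow> \<psi> (l / \<delta>) \<le> 1 / (2 * exp 1) * \<psi> l"
    using psi_decay[of "1 / (2 * exp 1)"] by auto
  define c where "c = \<delta> powr \<beta>\<^sub>2 / (2 * C * k\<^sub>2)"
  have "c * \<phi> (1 / t) \<le> K t" if t: "0 < t" for t
  proof -
    have l: "0 < \<delta> / t" using \<delta> t by simp
    have "\<psi> (\<delta> / t) \<le> (LBINT x:{0<..<t}. K x) + K t / (\<delta> / t)"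
      by (rule psi_le_integral_K[OF l t])
    also have "(LBINT x:{0<..<t}. K x) \<le> exp 1 * \<psi> (1 / t)" by (rule integral_K_le[OF t])
    also have "\<dots> \<le> \<psi> (\<delta> / t) / 2" using \<delta>(3)[OF l] \<delta>(1) by (simp add: field_simps)
    finally have "\<delta> / t * \<psi> (\<delta> / t) \<le> 2 * K t" using l t \<delta> by (simp add: field_simps)
    then have "C * (\<delta> / t * \<psi> (\<delta> / t)) \<le> C * (2 * K t)"
      using C by (intro mult_left_mono) auto
    with C(2)[OF l] have 1: "\<phi> (\<delta> / t) \<le> C * (2 * K t)" by linarith
    have "\<phi> (1 / \<delta> * (\<delta> / t)) \<le> k\<^sub>2 * (1 / \<delta>) powr \<beta>\<^sub>2 * \<phi> (\<delta> / t)"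
      using l \<delta> by (intro phi_scaling) auto
    also have "\<dots> \<le> k\<^sub>2 * (1 / \<delta>) powr \<beta>\<^sub>2 * (C * (2 * K t))"
      using 1 params by (intro mult_left_mono) auto
    finally have "\<phi> (1 / t) \<le> k\<^sub>2 * (1 / \<delta>) powr \<beta>\<^sub>2 * (C * (2 * K t))" using \<delta> by simp
    then show ?thesis using \<delta> params C by (simp add: c_def powr_divide field_simps)
  qed
  moreover have "0 < c" using \<delta> params C by (simp add: c_def)
  ultimately show thesis by (intro that)
qed

section \<open>The generalized inverse of the derivative\<close>

lemma deriv_phi: "0 < s \<Longrightarrow> deriv \<phi> s = \<psi> s"
  by (intro DERIV_imp_deriv DERIV_laplace_exponent[OF levy])

text \<open>\<open>\<psi>\<close> is monotone and continuous and takes values on both sides of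
  \<open>y\<close>, so it equals \<open>y\<close> at the infimum.\<close>

lemma deriv_inverse_props:
  assumes y: "0 < y"
  shows deriv_inverse_pos: "0 < deriv_inverse \<phi> y"
    and psi_deriv_inverse: "\<psi> (deriv_inverse \<phi> y) = y"
proof -
  let ?A = "{s. 0 < s \<and> deriv \<phi> s \<le> y}"
  have A: "?A = {s. 0 < s \<and> \<psi> s \<le> y}" by (auto simp: deriv_phi)
  define m where "m = Inf ?A"
  have \<psi>1: "0 < \<psi> 1" by (rule psi_pos) simp
  \<comment> \<open>This \<open>\<delta>\<close> makes \<open>\<psi> (1 / \<delta>) \<le> y\<close>,
    so the set is nonempty.\<close>
  obtain \<delta> where \<delta>: "0 < \<delta>" "\<delta> < 1" "\<And>l. 0 < l \<Longrightarrow> \<psi> (l / \<delta>) \<le> y / \<psi> 1 * \<psi> l"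
    using psi_decay[of "y / \<psi> 1"] y \<psi>1 by auto
  then have ne: "1 / \<delta> \<in> ?A" unfolding A using \<psi>1 \<delta>(3)[of 1] by simp
  \<comment> \<open>Read at \<open>l = d\<close>, the decay says that \<open>\<psi> d\<close> is at
    least \<open>2 * y\<close>; hence the set stays away from 0 and the infimum is positive.\<close>
  obtain d where d: "0 < d" "d < 1" "\<And>l. 0 < l \<Longrightarrow> \<psi> (l / d) \<le> \<psi> 1 / (2 * y) * \<psi> l"
    using psi_decay[of "\<psi> 1 / (2 * y)"] y \<psi>1 by auto
  have "2 * y \<le> \<psi> d" using d(3)[OF d(1)] d \<psi>1 y by (simp add: field_simps)
  then have lb: "d \<le> s" if "s \<in> ?A" for s
    using that laplace_exponent_deriv_antimono[OF levy, of s d] y unfolding A by force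
  then have bdd: "bdd_below ?A" by (meson bdd_belowI)
  have "d \<le> m" unfolding m_def by (intro cInf_greatest) (use ne in blast, rule lb)
  then have m: "0 < m" using d by simp
  have below: "y < \<psi> s" if "0 < s" "s < m" for s
    using that cInf_lower[OF _ bdd, of s] unfolding A m_def by force
  have above: "\<psi> s \<le> y" if "m < s" for s
  proof -
    have "?A \<noteq> {}" using ne by blast
    moreover have "Inf ?A < s" using that unfolding m_def .
    ultimately have "\<exists>u\<in>?A. u < s" by (rule cInf_lessD)
    then obtain u where u: "u \<in> ?A" "u < s" ..
    then have "0 < u" "\<psi> u \<le> y" unfolding A by auto
    with u show ?thesis using laplace_exponent_deriv_antimono[OF levy, of u s] by simp
  qed
  have cont: "(\<psi> \<longlongrightarrow> \<psi> m) (at m)" using isCont_laplace_exponent_deriv[OF levy m] by (simp add: isCont_def)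
  have "\<psi> m \<le> y"
  proof (rule tendsto_upperbound)
    show "(\<psi> \<longlongrightarrow> \<psi> m) (at_right m)"
      using cont by (simp add: filterlim_at_split)
    show "eventually (\<lambda>s. \<psi> s \<le> y) (at_right m)"
      using above by (auto simp: eventually_at_filter)
  qed simp
  moreover have "y \<le> \<psi> m"
  proof (rule tendsto_lowerbound)
    show "(\<psi> \<longlongrightarrow> \<psi> m) (at_left m)"
      using cont by (simp add: filterlim_at_split)
    show "eventually (\<lambda>s. y \<le> \<psi> s) (at_left m)"
      using below m by (auto simp: eventually_at_left[OF m] intro!: exI[of _ 0] less_imp_le)
  qed simp
  ultimately show "0 < deriv_inverse \<phi> y" "\<psi> (deriv_inverse \<phi> y) = y"
    using m unfolding deriv_inverse_def m_def by auto
qed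

lemma deriv_inverse_antimono:
  assumes "0 < y" "y \<le> y'"
  shows "deriv_inverse \<phi> y' \<le> deriv_inverse \<phi> y"
  unfolding deriv_inverse_def
proof (rule cInf_superset_mono)
  show "bdd_below {s. 0 < s \<and> deriv \<phi> s \<le> y'}" by (intro bdd_belowI[of _ 0]) auto
  have "deriv_inverse \<phi> y \<in> {s. 0 < s \<and> deriv \<phi> s \<le> y}"
    using deriv_inverse_props[OF assms(1)] by (simp add: deriv_phi)
  then show "{s. 0 < s \<and> deriv \<phi> s \<le> y} \<noteq> {}" by blast
qed (use assms in auto)

end

section \<open>The convolution identity for the transition density\<close>

section \<open>The density\<close>

text \<open>A difference at \<open>t\<close> would persist on an interval, which is not a null
  set.\<close>

lemma AE_lborel_eq_imp_eq:
  fixes f g :: "real \<Rightarrow> real"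
  assumes ae: "AE x in lborel. f x = g x" and cont: "isCont f t" "isCont g t"
  shows "f t = g t"
proof (rule ccontr)
  assume "f t \<noteq> g t"
  moreover have "((\<lambda>x. f x - g x) \<longlongrightarrow> f t - g t) (nhds t)"
    using cont by (intro tendsto_intros) (auto simp: continuous_within tendsto_at_iff_tendsto_nhds)
  ultimately have "eventually (\<lambda>x. f x - g x \<noteq> 0) (nhds t)"
    by (intro tendsto_imp_eventually_ne) auto
  then obtain d where d: "0 < d" "\<And>x. dist x t < d \<Longrightarrow> f x \<noteq> g x"
    unfolding eventually_nhds_metric by auto
  obtain N where N: "{x. f x \<noteq> g x} \<subseteq> N" "emeasure lborel N = 0" "N \<in> sets lborel"
    using ae by (auto elim!: AE_E)
  have "{t <..< t + d} \<subseteq> N" using d N(1) by (force simp: dist_real_def)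
  then have "emeasure lborel {t <..< t + d} \<le> emeasure lborel N"
    using N by (intro emeasure_mono) auto
  then show False using N d by simp
qed

locale scaling_subordinator =
  driftless_subordinator M S \<nu> + scaling_levy_density \<nu> \<beta>\<^sub>1 \<beta>\<^sub>2 k\<^sub>1 k\<^sub>2
  for M :: "'a measure" and S :: "real \<Rightarrow> 'a \<Rightarrow> real" and \<nu> :: "real \<Rightarrow> real" and \<beta>\<^sub>1 \<beta>\<^sub>2 k\<^sub>1 k\<^sub>2 :: real +
  fixes p :: "real \<Rightarrow> real \<Rightarrow> real"
  assumes density: "transition_density M S p"
begin

text \<open>The values of \<open>p r\<close> and \<open>K\<close> outside \<open>(0, \<infinity>)\<close> are unspecified; \<open>p0\<close> and \<open>K0\<close> replace them by \<open>0\<close>.\<close>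

definition p0 :: "real \<Rightarrow> real \<Rightarrow> real" where
  "p0 r t = indicator {0<..} t * p r t"

definition K0 :: "real \<Rightarrow> real" where
  "K0 s = indicator {0<..} s * K s"

text \<open>This is the probability of \<open>S r < u\<close>, written as an integral of the density
  so that it can be compared directly with convolution integrals; \<open>cdf_eq_prob\<close> gives
  the link to the law.\<close>

definition cdf_S :: "real \<Rightarrow> real \<Rightarrow> real" where
  "cdf_S r u = (LBINT x. indicator {..<u} x * p0 r x)"

lemma p_nonneg: "0 < r \<Longrightarrow> 0 < t \<Longrightarrow> 0 \<le> p r t"
  using density by (simp add: transition_density_def)

lemma p0_nonneg: "0 < r \<Longrightarrow> 0 \<le> p0 r t"
  by (auto simp: p0_def indicator_def p_nonneg)

lemma p0_simps [simp]: "0 < t \<Longrightarrow> p0 r t = p r t" "t \<le> 0 \<Longrightarrow> p0 r t = 0"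
  by (auto simp: p0_def)

lemma K0_simps [simp]: "0 < s \<Longrightarrow> K0 s = K s" "s \<le> 0 \<Longrightarrow> K0 s = 0"
  by (auto simp: K0_def)

lemma K0_nonneg: "0 \<le> K0 s"
  using levy_density_nonneg[OF levy, of s] by (cases "0 < s") auto

lemma K0_measurable [measurable]: "K0 \<in> borel_measurable borel"
proof -
  note [measurable] = levy_density_measurable[OF levy]
  have "(\<lambda>s. s * (indicator {0<..} s * \<nu> s)) \<in> borel_measurable borel" by measurable
  then show ?thesis by (simp add: K0_def[abs_def] mult_ac)
qed

lemma distributed_p0: "0 < r \<Longrightarrow> distributed M lborel (S r) (\<lambda>t. ennreal (p0 r t))"
  using density by (simp add: transition_density_def p0_def)

lemma p0_measurable [measurable]: "0 < r \<Longrightarrow> p0 r \<in> borel_measurable borel"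
  using distributed_real_measurable[OF _ distributed_p0] by (auto simp: p0_nonneg)

lemma p0_bounded:
  assumes r: "0 < r" obtains B where "0 \<le> B" "\<And>t. p0 r t \<le> B"
proof -
  obtain B where "\<And>t. 0 < t \<Longrightarrow> \<bar>p r t\<bar> \<le> B"
    using density r unfolding transition_density_def bounded_real by blast
  then have B: "p r t \<le> B" if "0 < t" for t using that by (meson abs_le_D1)
  then have "p0 r t \<le> max 0 B" for t by (cases "0 < t") (auto simp: le_max_iff_disj)
  then show thesis by (intro that[of "max 0 B"]) auto
qed

text \<open>The point 0 is excluded because the extension by 0 may jump there.\<close>

lemma isCont_p0: assumes r: "0 < r" and x: "x \<noteq> 0" shows "isCont (p0 r) x"
proof (cases "0 < x")
  case True
  have "(deriv ^^ 0) (p r) differentiable at x"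
    using density r True unfolding transition_density_def smooth_on_pos_def by blast
  then have "isCont (p r) x"
    using differentiable_imp_continuous_within by auto
  moreover have "eventually (\<lambda>y. p0 r y = p r y) (nhds x)"
    using eventually_nhds_in_open[of "{0<..}" x] True by (auto elim!: eventually_mono)
  ultimately show ?thesis by (simp add: isCont_cong)
next
  case False
  with x have "eventually (\<lambda>y. p0 r y = 0) (nhds x)"
    using eventually_nhds_in_open[of "{..<0}" x] by (auto elim!: eventually_mono)
  then show ?thesis by (simp add: isCont_cong)
qed

lemma laplace_p0:
  assumes r: "0 < r" and l: "0 \<le> l"
  shows "has_bochner_integral lborel (\<lambda>x. exp (- l * x) * p0 r x) (exp (- r * \<phi> l))"
proof -
  have "(LBINT x. p0 r x * exp (- l * x)) = expectation (\<lambda>\<omega>. exp (- l * S r \<omega>))"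
    using p0_nonneg[OF r] by (intro distributed_integral[OF distributed_p0[OF r]]) auto
  also have "\<dots> = exp (- r * \<phi> l)" using laplace_transform[of r l] r l by simp
  finally have eq: "(LBINT x. exp (- l * x) * p0 r x) = exp (- r * \<phi> l)" by (simp add: mult.commute)
  \<comment> \<open>A function that is not integrable has Bochner integral 0, whereas the value
    found is a positive exponential.\<close>
  then have "integrable lborel (\<lambda>x. exp (- l * x) * p0 r x)"
    using not_integrable_integral_eq by fastforce
  with eq show ?thesis by (simp add: has_bochner_integral_iff)
qed

lemma has_bochner_integral_p0: "0 < r \<Longrightarrow> has_bochner_integral lborel (p0 r) 1"
  using laplace_p0[of r 0] by (simp add: laplace_exponent_0)

text \<open>Viewing the probability density itself as a Levy density makes the calculus of Laplace
  exponents available for it.\<close>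

lemma levy_density_p: assumes r: "0 < r" shows "levy_density (p r)"
  unfolding levy_density_def set_integrable_def
proof (intro conjI allI impI p_nonneg[OF r])
  note [measurable] = p0_measurable[OF r]
  have "integrable lborel (\<lambda>x. min 1 (max 0 x) * p0 r x)"
  proof (rule Bochner_Integration.integrable_bound)
    show "integrable lborel (p0 r)"
      using has_bochner_integral_p0[OF r] by (simp add: has_bochner_integral_iff)
    show "AE x in lborel. norm (min 1 (max 0 x) * p0 r x) \<le> norm (p0 r x)"
      by (intro AE_I2) (auto simp: abs_mult intro!: mult_left_le_one_le)
  qed measurable
  also have "(\<lambda>x. min 1 (max 0 x) * p0 r x) = (\<lambda>x. indicator {0<..} x *\<^sub>R (min 1 x * p r x))"
    by (auto simp: p0_def indicator_def)
  finally show "integrable lborel (\<lambda>x. indicator {0<..} x *\<^sub>R (min 1 x * p r x))" .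
qed

lemma laplace_exponent_p:
  assumes r: "0 < r" and l: "0 \<le> l"
  shows "laplace_exponent (p r) l = 1 - exp (- r * \<phi> l)"
proof -
  have "laplace_exponent (p r) l = (LBINT x. p0 r x - exp (- l * x) * p0 r x)"
    unfolding laplace_exponent_def set_lebesgue_integral_def
    by (intro Bochner_Integration.integral_cong) (auto simp: p0_def algebra_simps)
  also have "\<dots> = 1 - exp (- r * \<phi> l)"
    using laplace_p0[OF r l] has_bochner_integral_p0[OF r]
    by (subst Bochner_Integration.integral_diff) (auto simp: has_bochner_integral_iff)
  finally show ?thesis .
qed

text \<open>The function \<open>1 - exp (- r * \<phi> l)\<close> is differentiated in two ways: as
  the Laplace exponent of \<open>p r\<close>, and by the chain rule.\<close>

lemma laplace_exponent_deriv_p: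
  assumes r: "0 < r" and l: "0 < l"
  shows "laplace_exponent_deriv (p r) l = r * \<psi> l * exp (- r * \<phi> l)"
proof (rule DERIV_unique)
  show "(laplace_exponent (p r) has_real_derivative laplace_exponent_deriv (p r) l) (at l)"
    by (rule DERIV_laplace_exponent[OF levy_density_p[OF r] l])
  have "((\<lambda>l. 1 - exp (- r * \<phi> l)) has_real_derivative r * \<psi> l * exp (- r * \<phi> l)) (at l)"
    using DERIV_laplace_exponent[OF levy l] by (auto intro!: derivative_eq_intros)
  then show "(laplace_exponent (p r) has_real_derivative r * \<psi> l * exp (- r * \<phi> l)) (at l)"
    by (rule has_field_derivative_transform_within_open[of _ _ _ "{0<..}"])
       (use l laplace_exponent_p[OF r] in auto)
qed

text \<open>Boundedness of the density makes the convolution finite at every \<open>t\<close>, not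
  merely almost everywhere.\<close>

lemma integrable_K0_p0:
  assumes r: "0 < r" shows "integrable lborel (\<lambda>s. K0 s * p0 r (t - s))"
proof (cases "0 < t")
  case True
  note [measurable] = p0_measurable[OF r]
  obtain B where B: "0 \<le> B" "\<And>t. p0 r t \<le> B" using p0_bounded[OF r] by blast
  show ?thesis
  proof (rule Bochner_Integration.integrable_bound)
    show "integrable lborel (\<lambda>s. B * (indicator {0<..<t} s *\<^sub>R K s))"
      using K_set_integrable[OF True] unfolding set_integrable_def by auto
    show "AE s in lborel. norm (K0 s * p0 r (t - s)) \<le> norm (B * (indicator {0<..<t} s *\<^sub>R K s))"
    proof (intro AE_I2)
      fix s :: real
      consider "s \<le> 0" | "t \<le> s" | "0 < s" "s < t" by linarith
      then show "norm (K0 s * p0 r (t - s)) \<le> norm (B * (indicator {0<..<t} s *\<^sub>R K s))"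
      proof cases
        case 3
        have "\<bar>K s\<bar> * \<bar>p0 r (t - s)\<bar> \<le> \<bar>K s\<bar> * \<bar>B\<bar>"
          using B p0_nonneg[OF r, of "t - s"] by (intro mult_left_mono) auto
        then show ?thesis using 3 by (simp add: abs_mult mult_ac)
      qed auto
    qed
  qed measurable
next
  case False
  then have "(\<lambda>s. K0 s * p0 r (t - s)) = (\<lambda>s. 0)"
    by (intro ext) (metis K0_simps(2) diff_le_0_iff_le linorder_le_cases mult_eq_0_iff order_trans p0_simps(2) not_le)
  then show ?thesis by simp
qed

text \<open>For \<open>u < t + 1\<close> one multiple of \<open>K\<close> on
  \<open>(0, t + 1)\<close> dominates all integrands. Continuity at \<open>u = t\<close> can fail
  only for \<open>s = t\<close>, a null set.\<close>

lemma isCont_K0_p0: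
  assumes r: "0 < r" and t: "0 < t"
  shows "isCont (\<lambda>t. LBINT s. K0 s * p0 r (t - s)) t"
proof -
  note [measurable] = p0_measurable[OF r]
  obtain B where B: "0 \<le> B" "\<And>t. p0 r t \<le> B" using p0_bounded[OF r] by blast
  show ?thesis
  proof (rule isCont_integral_dominated[where U="{..<t + 1}"])
    show "integrable lborel (\<lambda>s. B * (indicator {0<..<t + 1} s *\<^sub>R K s))"
      using K_set_integrable[of "t + 1"] t unfolding set_integrable_def by auto
    fix u assume u: "u \<in> {..<t + 1}"
    show "(\<lambda>s. K0 s * p0 r (u - s)) \<in> borel_measurable lborel" by measurable
    show "AE s in lborel. norm (K0 s * p0 r (u - s)) \<le> B * (indicator {0<..<t + 1} s *\<^sub>R K s)"
    proof (intro AE_I2)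
      fix s :: real
      consider "s \<le> 0" | "u \<le> s" | "0 < s" "s < u" by linarith
      then show "norm (K0 s * p0 r (u - s)) \<le> B * (indicator {0<..<t + 1} s *\<^sub>R K s)"
      proof cases
        case 2
        have "0 \<le> indicator {0<..<t + 1} s *\<^sub>R K s"
          using levy_density_nonneg[OF levy, of s] by (auto simp: indicator_def)
        then show ?thesis using 2 B(1) by simp
      next
        case 3
        have "K s * p0 r (u - s) \<le> K s * B"
          using B(2)[of "u - s"] K_nonneg[of s] 3 by (intro mult_left_mono) auto
        moreover have "\<bar>K s * p0 r (u - s)\<bar> = K s * p0 r (u - s)"
          using K_nonneg[of s] p0_nonneg[OF r, of "u - s"] 3
          by (intro abs_of_nonneg mult_nonneg_nonneg[of "K s"]) auto
        ultimately show ?thesis using 3 u by (simp add: mult_ac)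
      qed simp
    qed
  next
    show "AE s in lborel. isCont (\<lambda>u. K0 s * p0 r (u - s)) t"
      using AE_lborel_singleton[of t]
    proof eventually_elim
      fix s assume "s \<noteq> t"
      then have "isCont (p0 r) (t - s)" by (intro isCont_p0[OF r]) auto
      then have "isCont (\<lambda>u. p0 r (u - s)) t"
        by (rule isCont_o2[where f="\<lambda>u. u - s", rotated]) (intro continuous_intros)
      then show "isCont (\<lambda>u. K0 s * p0 r (u - s)) t"
        by (rule isCont_mult[OF continuous_const])
    qed
  qed auto
qed

text \<open>Both sides have Laplace transform \<open>r * \<psi> l * exp (- r * \<phi> l)\<close>.
  Uniqueness gives equality almost everywhere, and continuity of both sides gives it at each
  \<open>t > 0\<close>.\<close>

lemma density_identity:
  assumes r: "0 < r" and t: "0 < t"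
  shows "t * p r t = r * (LBINT s. K0 s * p0 r (t - s))"
proof -
  note [measurable] = p0_measurable[OF r]
  have "AE t in lborel. t * p0 r t = r * (LBINT s. K0 s * p0 r (t - s))"
  proof (rule laplace_transform_unique)
    fix l :: real assume l: "0 < l"
    have "integrable lborel (\<lambda>x. indicator {0<..} x *\<^sub>R (x * exp (- l * x) * p r x))"
      using levy_density_integrable_deriv[OF levy_density_p[OF r] l] unfolding set_integrable_def .
    moreover have "(LBINT x. indicator {0<..} x *\<^sub>R (x * exp (- l * x) * p r x)) = r * \<psi> l * exp (- r * \<phi> l)"
      using laplace_exponent_deriv_p[OF r l] unfolding laplace_exponent_deriv_def set_lebesgue_integral_def .
    moreover have "(\<lambda>x. indicator {0<..} x *\<^sub>R (x * exp (- l * x) * p r x)) = (\<lambda>x. exp (- l * x) * (x * p0 r x))"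
      by (auto simp: p0_def)
    ultimately show "has_bochner_integral lborel (\<lambda>x. exp (- l * x) * (x * p0 r x)) (r * (\<psi> l * exp (- r * \<phi> l)))"
      by (simp add: has_bochner_integral_iff mult.assoc)
    have "has_bochner_integral lborel (\<lambda>x. exp (- l * x) * K0 x) (\<psi> l)"
    proof -
      have "(\<lambda>x. indicator {0<..} x *\<^sub>R (x * exp (- l * x) * \<nu> x)) = (\<lambda>x. exp (- l * x) * K0 x)"
        by (auto simp: K0_def)
      then show ?thesis
        using levy_density_integrable_deriv[OF levy l]
        unfolding set_integrable_def laplace_exponent_deriv_def set_lebesgue_integral_def
        by (simp add: has_bochner_integral_iff)
    qed
    then have "has_bochner_integral lborel (\<lambda>t. exp (- l * t) * (LBINT s. K0 s * p0 r (t - s))) (\<psi> l * exp (- r * \<phi> l))"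
      using l by (intro has_bochner_integral_laplace_convolution laplace_p0[OF r] integrable_K0_p0[OF r])
        (auto simp: K0_nonneg p0_nonneg[OF r])
    then have "has_bochner_integral lborel (\<lambda>t. r * (exp (- l * t) * (LBINT s. K0 s * p0 r (t - s)))) (r * (\<psi> l * exp (- r * \<phi> l)))"
      by (rule has_bochner_integral_mult_right)
    then show "has_bochner_integral lborel (\<lambda>t. exp (- l * t) * (r * (LBINT s. K0 s * p0 r (t - s)))) (r * (\<psi> l * exp (- r * \<phi> l)))"
      by (simp add: mult_ac)
  next
    fix x :: real
    show "0 \<le> x * p0 r x" by (cases "0 < x") (auto simp: p_nonneg[OF r])
    show "0 \<le> r * (LBINT s. K0 s * p0 r (x - s))"
      using r by (intro mult_nonneg_nonneg Bochner_Integration.integral_nonneg) (auto simp: K0_nonneg p0_nonneg)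
    assume x: "x \<le> 0"
    then show "x * p0 r x = 0" by simp
    have "(\<lambda>s. K0 s * p0 r (x - s)) = (\<lambda>s. 0)"
    proof
      fix s show "K0 s * p0 r (x - s) = 0" using x by (cases "s \<le> 0") auto
    qed
    then show "r * (LBINT s. K0 s * p0 r (x - s)) = 0" by simp
  qed measurable
  then have "t * p0 r t = r * (LBINT s. K0 s * p0 r (t - s))"
    by (rule AE_lborel_eq_imp_eq) (use t in \<open>auto intro!: continuous_intros isCont_p0[OF r] isCont_K0_p0[OF r]\<close>)
  then show ?thesis using t by simp
qed

section \<open>The distribution function, and density bounds in terms of it\<close>

lemma integrable_cdf: "0 < r \<Longrightarrow> integrable lborel (\<lambda>x. indicator {..<u} x * p0 r x)"
  using has_bochner_integral_p0[of r] integrable_mult_indicator[of "{..<u}" lborel "p0 r"]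
  by (simp add: has_bochner_integral_iff)

text \<open>The substitution \<open>x = t - s\<close> brings the distribution function into the form
  in which it appears inside the convolution.\<close>

lemma cdf_reflect:
  assumes "0 < r"
  shows "has_bochner_integral lborel (\<lambda>s. indicator {0<..} s * p0 r (t - s)) (cdf_S r t)"
proof -
  have "has_bochner_integral lborel (\<lambda>x. indicator {..<t} x * p0 r x) (cdf_S r t)"
    using integrable_cdf[OF assms] by (simp add: cdf_S_def has_bochner_integral_iff)
  then have "has_bochner_integral lborel (\<lambda>s. indicator {..<t} (t + (-1) * s) * p0 r (t + (-1) * s)) (cdf_S r t)"
    by (subst (asm) lborel_has_bochner_integral_real_affine_iff[where c="-1" and t=t]) auto
  also have "(\<lambda>s. indicator {..<t} (t + (-1) * s) * p0 r (t + (-1) * s)) = (\<lambda>s. indicator {0<..} s * p0 r (t - s))"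
    by (auto simp: indicator_def)
  finally show ?thesis .
qed

lemma cdf_nonneg: "0 < r \<Longrightarrow> 0 \<le> cdf_S r t"
  unfolding cdf_S_def by (intro Bochner_Integration.integral_nonneg) (auto simp: p0_nonneg)

lemma cdf_le_1: assumes r: "0 < r" shows "cdf_S r t \<le> 1"
proof -
  have "cdf_S r t \<le> (LBINT x. p0 r x)"
    unfolding cdf_S_def using has_bochner_integral_p0[OF r]
    by (intro integral_mono integrable_cdf[OF r]) (auto simp: has_bochner_integral_iff indicator_def p0_nonneg[OF r])
  then show ?thesis using has_bochner_integral_p0[OF r] by (simp add: has_bochner_integral_iff)
qed

text \<open>Only \<open>0 < s < t\<close> contributes to the convolution, and there
  \<open>K s\<close> is at least \<open>K t\<close>.\<close>

lemma density_lower: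
  assumes r: "0 < r" and t: "0 < t"
  shows "r * (K t * cdf_S r t) \<le> t * p r t"
proof -
  have "K t * cdf_S r t = (LBINT s. K t * (indicator {0<..} s * p0 r (t - s)))"
    using cdf_reflect[OF r, of t] by (simp add: has_bochner_integral_iff)
  also have "\<dots> \<le> (LBINT s. K0 s * p0 r (t - s))"
  proof (intro integral_mono integrable_K0_p0[OF r])
    show "integrable lborel (\<lambda>s. K t * (indicator {0<..} s * p0 r (t - s)))"
      using cdf_reflect[OF r, of t] by (simp add: has_bochner_integral_iff)
    fix s :: real
    consider "s \<le> 0" | "t \<le> s" | "0 < s" "s < t" by linarith
    then show "K t * (indicator {0<..} s * p0 r (t - s)) \<le> K0 s * p0 r (t - s)"
    proof cases
      case 3
      then have "K t * p0 r (t - s) \<le> K s * p0 r (t - s)"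
        using K_antimono[of s t] by (intro mult_right_mono p0_nonneg[OF r]) auto
      then show ?thesis using 3 by simp
    qed auto
  qed
  finally show ?thesis using density_identity[OF r t] r by simp
qed

text \<open>Split the convolution at \<open>a\<close>: for \<open>s < a\<close> the density is at
  most \<open>B\<close>, for \<open>s \<ge> a\<close> the factor \<open>K s\<close> is at most
  \<open>K a\<close>.\<close>

lemma density_upper:
  assumes r: "0 < r" and t: "0 < t" and a: "0 < a" and B: "0 \<le> B"
    and bound: "\<And>s. 0 < s \<Longrightarrow> t - a < s \<Longrightarrow> s < t \<Longrightarrow> p r s \<le> B"
  shows "t * p r t \<le> r * (B * (exp 1 * \<psi> (1 / a)) + K a * cdf_S r t)"
proof -
  have 1: "integrable lborel (\<lambda>s. B * (indicator {0<..<a} s * K s))"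
    using K_set_integrable[OF a] unfolding set_integrable_def by auto
  have 2: "integrable lborel (\<lambda>s. K a * (indicator {0<..} s * p0 r (t - s)))"
    using cdf_reflect[OF r, of t] by (simp add: has_bochner_integral_iff)
  have "(LBINT s. K0 s * p0 r (t - s)) \<le>
      (LBINT s. B * (indicator {0<..<a} s * K s) + K a * (indicator {0<..} s * p0 r (t - s)))"
  proof (intro integral_mono integrable_K0_p0[OF r] Bochner_Integration.integrable_add 1 2)
    fix s :: real
    have tail: "0 \<le> K a * (indicator {0<..} s * p0 r (t - s))"
      using K_nonneg[OF a] p0_nonneg[OF r, of "t - s"] by (intro mult_nonneg_nonneg[of "K a"]) auto
    have head: "0 \<le> B * (indicator {0<..<a} s * K s)"
      using B levy_density_nonneg[OF levy, of s] by (auto simp: indicator_def)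
    consider "s \<le> 0" | "t \<le> s" | "0 < s" "s < t" "s < a" | "0 < s" "a \<le> s" by linarith
    then show "K0 s * p0 r (t - s) \<le> B * (indicator {0<..<a} s * K s) + K a * (indicator {0<..} s * p0 r (t - s))"
    proof cases
      case 3
      then have "K s * p0 r (t - s) \<le> K s * B"
        using K_nonneg[of s] bound[of "t - s"] by (intro mult_left_mono) auto
      then have "K s * p0 r (t - s) + 0 \<le> K s * B + K a * (indicator {0<..} s * p0 r (t - s))"
        using tail by (intro add_mono)
      then show ?thesis using 3 by (simp add: mult_ac)
    next
      case 4
      then have "K s * p0 r (t - s) \<le> K a * p0 r (t - s)"
        using K_antimono[of a s] a by (intro mult_right_mono p0_nonneg[OF r]) auto
      then show ?thesis using 4 by simp
    qed (use head tail in auto)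
  qed
  also have "\<dots> = B * (LBINT s:{0<..<a}. K s) + K a * cdf_S r t"
    using 1 2 cdf_reflect[OF r, of t] by (subst Bochner_Integration.integral_add)
      (auto simp: has_bochner_integral_iff set_lebesgue_integral_def)
  also have "\<dots> \<le> B * (exp 1 * \<psi> (1 / a)) + K a * cdf_S r t"
    using integral_K_le[OF a] B by (intro add_right_mono mult_left_mono)
  finally show ?thesis using density_identity[OF r t] r by simp
qed

text \<open>Exponential Markov inequality: \<open>exp (l * (u - x))\<close> is at least 1 for
  \<open>x < u\<close>.\<close>

lemma cdf_chernoff:
  assumes r: "0 < r" and l: "0 \<le> l"
  shows "cdf_S r u \<le> exp (l * u - r * \<phi> l)"
proof -
  have "cdf_S r u \<le> (LBINT x. exp (l * u) * (exp (- l * x) * p0 r x))"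
    unfolding cdf_S_def
  proof (intro integral_mono integrable_cdf[OF r])
    show "integrable lborel (\<lambda>x. exp (l * u) * (exp (- l * x) * p0 r x))"
      using laplace_p0[OF r l] by (auto simp: has_bochner_integral_iff)
    fix x :: real
    show "indicator {..<u} x * p0 r x \<le> exp (l * u) * (exp (- l * x) * p0 r x)"
    proof (cases "x < u")
      case True
      then have "1 * p0 r x \<le> exp (l * (u - x)) * p0 r x"
        using l p0_nonneg[OF r] by (intro mult_right_mono) auto
      also have "\<dots> = exp (l * u) * (exp (- l * x) * p0 r x)"
        by (simp add: right_diff_distrib exp_diff exp_minus field_simps)
      finally show ?thesis using True by simp
    qed (simp add: p0_nonneg[OF r])
  qed
  also have "\<dots> = exp (l * u - r * \<phi> l)"
    using laplace_p0[OF r l] by (simp add: has_bochner_integral_iff exp_add[symmetric])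
  finally show ?thesis .
qed

text \<open>Markov's inequality for \<open>1 - exp (- x / u)\<close>, which is at least
  \<open>1 - exp (- 1)\<close> once \<open>x \<ge> u\<close> and has mean at most
  \<open>r * \<phi> (1 / u)\<close>.\<close>

lemma cdf_markov:
  assumes r: "0 < r" and u: "0 < u" and small: "r * \<phi> (1 / u) \<le> (1 - exp (-1)) / 2"
  shows "1 / 2 \<le> cdf_S r u"
proof -
  let ?q = "1 - exp (- 1) :: real"
  have q: "0 < ?q" by simp
  have int: "integrable lborel (\<lambda>x. p0 r x - exp (- (1 / u) * x) * p0 r x)"
    using laplace_p0[OF r, of "1 / u"] has_bochner_integral_p0[OF r] u
    by (auto simp: has_bochner_integral_iff)
  have "(LBINT x. ?q * (p0 r x - indicator {..<u} x * p0 r x)) \<le>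
      (LBINT x. p0 r x - exp (- (1 / u) * x) * p0 r x)"
  proof (intro integral_mono int)
    show "integrable lborel (\<lambda>x. ?q * (p0 r x - indicator {..<u} x * p0 r x))"
      using integrable_cdf[OF r, of u] has_bochner_integral_p0[OF r] by (auto simp: has_bochner_integral_iff)
    fix x :: real
    consider "x \<le> 0" | "0 < x" "x < u" | "u \<le> x" by linarith
    then show "?q * (p0 r x - indicator {..<u} x * p0 r x) \<le> p0 r x - exp (- (1 / u) * x) * p0 r x"
    proof cases
      case 2
      have "exp (- (1 / u) * x) * p0 r x \<le> p0 r x"
        using 2 u p0_nonneg[OF r, of x] by (intro mult_left_le_one_le) auto
      then show ?thesis using 2 by simp
    next
      case 3
      then have "exp (- (1 / u) * x) * p0 r x \<le> exp (- 1) * p0 r x"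
        using u p0_nonneg[OF r, of x] by (intro mult_right_mono) auto
      then show ?thesis using 3 by (simp add: algebra_simps)
    qed simp
  qed
  also have "\<dots> = 1 - exp (- (r * \<phi> (1 / u)))"
    using laplace_p0[OF r, of "1 / u"] has_bochner_integral_p0[OF r] u
    by (subst Bochner_Integration.integral_diff) (auto simp: has_bochner_integral_iff)
  also have "\<dots> \<le> r * \<phi> (1 / u)" using exp_ge_add_one_self[of "- (r * \<phi> (1 / u))"] by simp
  also have "\<dots> \<le> ?q / 2" by (rule small)
  finally have "(LBINT x. ?q * (p0 r x - indicator {..<u} x * p0 r x)) \<le> ?q / 2" .
  moreover have "(LBINT x. ?q * (p0 r x - indicator {..<u} x * p0 r x)) = ?q * (1 - cdf_S r u)"
    using integrable_cdf[OF r, of u] has_bochner_integral_p0[OF r]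
    by (subst integral_mult_right_zero, subst Bochner_Integration.integral_diff)
       (auto simp: has_bochner_integral_iff cdf_S_def)
  ultimately have "?q * (1 - cdf_S r u) \<le> ?q * (1 / 2)" by simp
  then have "1 - cdf_S r u \<le> 1 / 2" using q by (subst (asm) mult_le_cancel_left_pos) auto
  then show ?thesis by simp
qed

lemma cdf_eq_prob: assumes r: "0 < r" shows "cdf_S r u = measure (distr M borel (S r)) {..<u}"
proof -
  have [measurable]: "S r \<in> borel_measurable M" using measurable_S[of r] r by simp
  have "cdf_S r u = (LBINT x. p0 r x * indicator {..<u} x)"
    by (simp add: cdf_S_def mult.commute)
  also have "\<dots> = expectation (\<lambda>\<omega>. indicator {..<u} (S r \<omega>))"
    using p0_nonneg[OF r] by (intro distributed_integral[OF distributed_p0[OF r]]) auto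
  also have "\<dots> = (LINT x|distr M borel (S r). indicator {..<u} x)"
    by (subst integral_distr) auto
  also have "\<dots> = measure (distr M borel (S r)) {..<u}" by simp
  finally show ?thesis .
qed

text \<open>If \<open>n\<close> independent increments over time \<open>r / n\<close> all stay below
  \<open>u / n\<close>, their sum stays below \<open>u\<close>. The sum telescopes to
  \<open>S r - S 0\<close>, which has the law of \<open>S r\<close> by stationarity.\<close>

lemma cdf_power:
  assumes r: "0 < r" and n: "0 < n"
  shows "cdf_S (r / real n) (u / real n) ^ n \<le> cdf_S r u"
proof -
  define \<tau> where "\<tau> i = real i * (r / real n)" for i :: nat
  define X where "X i \<omega> = S (\<tau> (Suc i)) \<omega> - S (\<tau> i) \<omega>" for i \<omega>
  have \<tau>0: "0 \<le> \<tau> i" for i using r by (simp add: \<tau>_def)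
  have \<tau>_le: "\<tau> i \<le> \<tau> (Suc i)" for i using r by (simp add: \<tau>_def divide_right_mono)
  have S[measurable]: "S (\<tau> i) \<in> borel_measurable M" for i using measurable_S[OF \<tau>0] .
  have X[measurable]: "X i \<in> borel_measurable M" for i unfolding X_def by measurable
  have S0[measurable]: "S 0 \<in> borel_measurable M" "S r \<in> borel_measurable M"
    using measurable_S[of 0] measurable_S[of r] r by auto
  have indep: "indep_vars (\<lambda>_. borel) X {..<n}"
    unfolding X_def[abs_def] using r \<tau>0
    by (intro indep_increments monotone_onI) (auto simp: \<tau>_def intro!: divide_right_mono mult_right_mono)
  have "distr M borel (X i) = distr M borel (S (r / real n))" for i
    using stationary_increments[OF \<tau>0 \<tau>_le, of i]
    by (simp add: X_def[abs_def] \<tau>_def algebra_simps add_divide_distrib)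
  then have probX: "prob (X i -` {..<u / real n} \<inter> space M) = cdf_S (r / real n) (u / real n)" for i
    using r n measure_distr[OF X[of i], of "{..<u / real n}"] by (simp add: cdf_eq_prob)
  have "cdf_S (r / real n) (u / real n) ^ n = (\<Prod>i<n. prob (X i -` {..<u / real n} \<inter> space M))"
    by (simp add: probX)
  also have "\<dots> = prob (\<Inter>i\<in>{..<n}. X i -` {..<u / real n} \<inter> space M)"
    using n by (intro indep_varsD_finite[OF indep, symmetric]) auto
  also have "\<dots> \<le> prob ((\<lambda>\<omega>. S r \<omega> - S 0 \<omega>) -` {..<u} \<inter> space M)"
  proof (intro finite_measure_mono subsetI)
    fix \<omega> assume \<omega>: "\<omega> \<in> (\<Inter>i\<in>{..<n}. X i -` {..<u / real n} \<inter> space M)"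
    then have "\<omega> \<in> space M" using n by (auto split: if_splits)
    have less: "X i \<omega> < u / real n" if "i < n" for i using \<omega> that by (auto split: if_splits)
    have "S r \<omega> - S 0 \<omega> = (\<Sum>i<n. X i \<omega>)"
      using sum_lessThan_telescope[of "\<lambda>i. S (\<tau> i) \<omega>" n] n by (simp add: X_def \<tau>_def)
    also have "\<dots> < (\<Sum>i<n. u / real n)"
      using less n by (intro sum_strict_mono) auto
    also have "\<dots> = u" using n by simp
    finally show "\<omega> \<in> (\<lambda>\<omega>. S r \<omega> - S 0 \<omega>) -` {..<u} \<inter> space M" using \<open>\<omega> \<in> space M\<close> by simp
  qed measurable
  also have "\<dots> = measure (distr M borel (\<lambda>\<omega>. S r \<omega> - S 0 \<omega>)) {..<u}"
    by (subst measure_distr) auto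
  also have "\<dots> = cdf_S r u"
    using stationary_increments[of 0 r] r by (simp add: cdf_eq_prob)
  finally show ?thesis .
qed

end

section \<open>Estimates at the point \<open>\<mu>\<close>, and the resulting density bounds\<close>

context scaling_subordinator
begin

abbreviation \<mu> :: "real \<Rightarrow> real \<Rightarrow> real" where
  "\<mu> r t \<equiv> deriv_inverse \<phi> (t / r)"

lemma mu_pos: "0 < r \<Longrightarrow> 0 < t \<Longrightarrow> 0 < \<mu> r t"
  by (intro deriv_inverse_pos) simp

lemma psi_mu: "0 < r \<Longrightarrow> 0 < t \<Longrightarrow> \<psi> (\<mu> r t) = t / r"
  by (intro psi_deriv_inverse) simp

text \<open>This converts the exponent \<open>r * \<phi> (\<mu> r t)\<close> of the upper bounds
  into the \<open>t * \<mu> r t\<close> of the theorem.\<close>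

lemma t_mu_le: assumes "0 < r" "0 < t" shows "t * \<mu> r t \<le> r * \<phi> (\<mu> r t)"
  using laplace_exponent_deriv_le[OF levy mu_pos[OF assms]] assms by (simp add: psi_mu field_simps)

lemma phi_mu_antimono:
  assumes "0 < r" "0 < u" "u \<le> t"
  shows "\<phi> (\<mu> r t) \<le> \<phi> (\<mu> r u)"
  using assms mu_pos[of r t]
  by (intro laplace_exponent_mono[OF levy] deriv_inverse_antimono) (auto intro: divide_right_mono)

text \<open>The Chernoff exponent \<open>l * u - r * \<phi> l\<close> is stationary at
  \<open>l = \<mu> r u\<close>. Its value there is \<open>- r\<close> times the gap
  \<open>\<phi> l - l * \<psi> l\<close>, to which \<open>phi_psi_gap\<close> applies.\<close>

lemma cdf_upper:
  obtains \<eta> where "0 < \<eta>" "\<And>r u. 0 < r \<Longrightarrow> 0 < u \<Longrightarrow> cdf_S r u \<le> exp (- \<eta> * (r * \<phi> (\<mu> r u)))"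
proof -
  obtain \<eta> where \<eta>: "0 < \<eta>" "\<And>l. 0 < l \<Longrightarrow> \<eta> * \<phi> l \<le> \<phi> l - l * \<psi> l" using phi_psi_gap by blast
  have "cdf_S r u \<le> exp (- \<eta> * (r * \<phi> (\<mu> r u)))" if r: "0 < r" and u: "0 < u" for r u
  proof -
    have "cdf_S r u \<le> exp (\<mu> r u * u - r * \<phi> (\<mu> r u))"
      using mu_pos[OF r u] by (intro cdf_chernoff[OF r]) auto
    also have "\<mu> r u * u - r * \<phi> (\<mu> r u) = - (r * (\<phi> (\<mu> r u) - \<mu> r u * \<psi> (\<mu> r u)))"
      using r u by (simp add: psi_mu field_simps)
    also have "exp \<dots> \<le> exp (- (r * (\<eta> * \<phi> (\<mu> r u))))"
      using \<eta>(2)[OF mu_pos[OF r u]] r by simp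
    finally show ?thesis by (simp add: mult_ac)
  qed
  with \<eta>(1) show thesis by (rule that)
qed

text \<open>If \<open>1 / u\<close> lies beyond \<open>\<mu> r u\<close>, then
  \<open>\<psi> (1 / u) \<le> u / r\<close>, which bounds the left side by a constant; otherwise
  monotonicity suffices. It serves the case in which the splitting point is
  \<open>u / 2\<close>.\<close>

lemma phi_inverse_le:
  obtains C where "1 \<le> C" "\<And>r u. 0 < r \<Longrightarrow> 0 < u \<Longrightarrow> r * \<phi> (1 / u) \<le> r * \<phi> (\<mu> r u) + C"
proof -
  obtain C where C: "1 \<le> C" "\<And>l. 0 < l \<Longrightarrow> \<phi> l \<le> C * (l * \<psi> l)" using phi_le_psi by blast
  have "r * \<phi> (1 / u) \<le> r * \<phi> (\<mu> r u) + C" if r: "0 < r" and u: "0 < u" for r u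
  proof (cases "1 / u \<le> \<mu> r u")
    case True
    then have "r * \<phi> (1 / u) \<le> r * \<phi> (\<mu> r u)"
      using r u by (intro mult_left_mono laplace_exponent_mono[OF levy]) auto
    then show ?thesis using C by linarith
  next
    case False
    then have "\<psi> (1 / u) \<le> u / r"
      using laplace_exponent_deriv_antimono[OF levy mu_pos[OF r u], of "1 / u"] by (simp add: psi_mu[OF r u])
    then have "r * (C * (1 / u * \<psi> (1 / u))) \<le> r * (C * (1 / u * (u / r)))"
      using r u C by (intro mult_left_mono) auto
    moreover have "r * \<phi> (1 / u) \<le> r * (C * (1 / u * \<psi> (1 / u)))"
      using C(2)[of "1 / u"] r u by (intro mult_left_mono) auto
    ultimately have "r * \<phi> (1 / u) \<le> C" using r u by simp
    moreover have "0 \<le> r * \<phi> (\<mu> r u)" using phi_pos[OF mu_pos[OF r u]] r by simp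
    ultimately show ?thesis by linarith
  qed
  with C(1) show thesis by (rule that)
qed

text \<open>The hypothesis on \<open>h\<close> is later applied to the supremum of \<open>s * p r s\<close>, whose share \<open>h / 2\<close> can then be
  absorbed.\<close>

lemma density_upper_step:
  obtains D \<eta> where "0 < D" "0 < \<eta>"
    "\<And>r u h. 0 < r \<Longrightarrow> 0 < u \<Longrightarrow> (\<And>s. 0 < s \<Longrightarrow> s \<le> u \<Longrightarrow> s * p r s \<le> h) \<Longrightarrow>
       u * p r u \<le> h / 2 + D * exp (- \<eta> * (r * \<phi> (\<mu> r u)))"
proof -
  obtain \<eta> where \<eta>: "0 < \<eta>" "\<And>r u. 0 < r \<Longrightarrow> 0 < u \<Longrightarrow> cdf_S r u \<le> exp (- \<eta> * (r * \<phi> (\<mu> r u)))"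
    using cdf_upper by blast
  obtain C where C: "1 \<le> C" "\<And>r u. 0 < r \<Longrightarrow> 0 < u \<Longrightarrow> r * \<phi> (1 / u) \<le> r * \<phi> (\<mu> r u) + C"
    using phi_inverse_le by blast
  \<comment> \<open>Here \<open>exp 1\<close> cancels the factor in \<open>density_upper\<close>; of
    the 4, one 2 cancels that in \<open>p r s \<le> 2 * h / u\<close> and the other leaves
    \<open>h / 2\<close>.\<close>
  obtain \<delta> where \<delta>: "0 < \<delta>" "\<delta> < 1" "\<And>l. 0 < l \<Longrightarrow> \<psi> (l / \<delta>) \<le> 1 / (4 * exp 1) * \<psi> l"
    using psi_decay[of "1 / (4 * exp 1)"] by auto
  define A where "A = exp 1 * (k\<^sub>2 * (1 / \<delta>) powr \<beta>\<^sub>2) + exp 1 * (k\<^sub>2 * 2 powr \<beta>\<^sub>2)"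
  have A: "0 < A" unfolding A_def using params \<delta> by (intro add_pos_pos mult_pos_pos) auto
  have step: "u * p r u \<le> h / 2 + A * (4 / \<eta> + C) * exp (- (\<eta> / 2) * (r * \<phi> (\<mu> r u)))"
    if r: "0 < r" and u: "0 < u" and h: "\<And>s. 0 < s \<Longrightarrow> s \<le> u \<Longrightarrow> s * p r s \<le> h" for r u h
  proof -
    let ?m = "\<mu> r u"
    define x where "x = r * \<phi> ?m"
    have m: "0 < ?m" by (rule mu_pos[OF r u])
    have x: "0 < x" using phi_pos[OF m] r by (simp add: x_def)
    have h0: "0 \<le> h" using h[OF u] p_nonneg[OF r u] u by (smt (verit) mult_nonneg_nonneg)
    \<comment> \<open>The first bound makes \<open>\<psi> (1 / a)\<close> small; the second keeps
      \<open>s\<close> above \<open>u / 2\<close>, where \<open>s * p r s \<le> h\<close> bounds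
      \<open>p r s\<close>.\<close>
    define a where "a = min (\<delta> / ?m) (u / 2)"
    have "0 < a" using \<delta> m u by (simp add: a_def)
    moreover have "a \<le> \<delta> / ?m" unfolding a_def by (rule min.cobounded1)
    moreover have "a \<le> u / 2" unfolding a_def by (rule min.cobounded2)
    ultimately have a: "0 < a" "a \<le> \<delta> / ?m" "a \<le> u / 2" .
    have "p r s \<le> 2 * h / u" if s: "0 < s" "u - a < s" "s < u" for s
    proof -
      have "u / 2 * p r s \<le> s * p r s" using s a p_nonneg[OF r s(1)] by (intro mult_right_mono) auto
      also have "\<dots> \<le> h" using s by (intro h) auto
      finally show ?thesis using u by (simp add: field_simps)
    qed
    then have "u * p r u \<le> r * (2 * h / u * (exp 1 * \<psi> (1 / a)) + K a * cdf_S r u)"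
      using h0 u by (intro density_upper[OF r u a(1)]) auto
    moreover have "r * (2 * h / u * (exp 1 * \<psi> (1 / a))) \<le> h / 2"
    proof -
      have "\<psi> (1 / a) \<le> \<psi> (?m / \<delta>)"
        using a \<delta> m by (intro laplace_exponent_deriv_antimono[OF levy]) (auto simp: field_simps)
      also have "\<dots> \<le> 1 / (4 * exp 1) * (u / r)" using \<delta>(3)[OF m] by (simp add: psi_mu[OF r u])
      finally have "r * (2 * h / u * (exp 1 * \<psi> (1 / a))) \<le> r * (2 * h / u * (exp 1 * (1 / (4 * exp 1) * (u / r))))"
        using r u h0 by (intro mult_left_mono) auto
      also have "\<dots> = h / 2" using r u by simp
      finally show ?thesis .
    qed
    moreover have "r * (K a * cdf_S r u) \<le> A * (4 / \<eta> + C) * exp (- (\<eta> / 2) * x)"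
    proof -
      have "K a \<le> K (\<delta> / ?m) + K (u / 2)"
        using K_nonneg[of "\<delta> / ?m"] K_nonneg[of "u / 2"] \<delta> m u by (auto simp: a_def min_def)
      moreover have "K (\<delta> / ?m) \<le> exp 1 * (k\<^sub>2 * (1 / \<delta>) powr \<beta>\<^sub>2) * \<phi> ?m"
        using K_le[of "\<delta> / ?m"] phi_scaling(2)[OF m, of "1 / \<delta>"] \<delta> m
        by (simp add: mult.assoc order_trans[OF _ mult_left_mono])
      moreover have "K (u / 2) \<le> exp 1 * (k\<^sub>2 * 2 powr \<beta>\<^sub>2) * \<phi> (1 / u)"
        using K_le[of "u / 2"] phi_scaling(2)[of "1 / u" 2] u
        by (simp add: mult.assoc order_trans[OF _ mult_left_mono])
      moreover have "exp 1 * (k\<^sub>2 * (1 / \<delta>) powr \<beta>\<^sub>2) * \<phi> ?m \<le> A * \<phi> ?m"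
        using phi_pos[OF m] params by (intro mult_right_mono) (auto simp: A_def)
      moreover have "exp 1 * (k\<^sub>2 * 2 powr \<beta>\<^sub>2) * \<phi> (1 / u) \<le> A * \<phi> (1 / u)"
        using phi_pos[of "1 / u"] params u by (intro mult_right_mono) (auto simp: A_def)
      ultimately have "K a \<le> A * \<phi> ?m + A * \<phi> (1 / u)" by linarith
      then have "r * K a \<le> r * (A * \<phi> ?m + A * \<phi> (1 / u))" using r by (intro mult_left_mono) auto
      also have "\<dots> = A * (x + r * \<phi> (1 / u))" by (simp add: x_def algebra_simps)
      also have "\<dots> \<le> A * (x + (x + C))"
        using C(2)[OF r u] A by (intro mult_left_mono add_left_mono) (auto simp: x_def)
      finally have 1: "r * K a \<le> A * (2 * x + C)" by simp
      have 2: "cdf_S r u \<le> exp (- \<eta> * x)" using \<eta>(2)[OF r u] by (simp add: x_def)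
      have "r * (K a * cdf_S r u) \<le> A * (2 * x + C) * exp (- \<eta> * x)"
        using mult_mono[OF 1 2] A C x cdf_nonneg[OF r] by (simp add: mult.assoc)
      \<comment> \<open>Half of the exponential decay is spent on the linear factor
        \<open>x\<close>; this produces \<open>4 / \<eta>\<close> and leaves the rate
        \<open>\<eta> / 2\<close>.\<close>
      also have "\<dots> = A * (2 * (x * exp (- (\<eta> / 2) * x)) + C * exp (- (\<eta> / 2) * x)) * exp (- (\<eta> / 2) * x)"
        by (simp add: algebra_simps flip: exp_add)
      also have "\<dots> \<le> A * (2 * (1 / (\<eta> / 2)) + C * 1) * exp (- (\<eta> / 2) * x)"
        using mult_exp_le[of "\<eta> / 2" x] \<eta> A C x
        by (intro mult_right_mono mult_left_mono add_mono) auto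
      finally show ?thesis by simp
    qed
    ultimately show ?thesis by (simp add: distrib_left x_def)
  qed
  have "0 < A * (4 / \<eta> + C)" using A C(1) \<eta>(1) by (intro mult_pos_pos add_pos_pos) auto
  moreover have "0 < \<eta> / 2" using \<eta>(1) by simp
  ultimately show thesis using step by (rule that)
qed

text \<open>Take \<open>h\<close> to be the supremum of \<open>s * p r s\<close> over
  \<open>(0, t]\<close>. It is finite since \<open>p r\<close> is bounded, so \<open>h / 2\<close>
  can be subtracted. The error term at \<open>u \<le> t\<close> is at most that at \<open>t\<close>
  by \<open>phi_mu_antimono\<close>.\<close>

lemma density_upper_exp:
  obtains D \<eta> where "0 < D" "0 < \<eta>"
    "\<And>r t. 0 < r \<Longrightarrow> 0 < t \<Longrightarrow> t * p r t \<le> D * exp (- \<eta> * (r * \<phi> (\<mu> r t)))"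
proof -
  obtain D \<eta> where D: "0 < D" "0 < \<eta>"
    and step: "\<And>r u h. 0 < r \<Longrightarrow> 0 < u \<Longrightarrow> (\<And>s. 0 < s \<Longrightarrow> s \<le> u \<Longrightarrow> s * p r s \<le> h) \<Longrightarrow>
       u * p r u \<le> h / 2 + D * exp (- \<eta> * (r * \<phi> (\<mu> r u)))"
    using density_upper_step by blast
  have "t * p r t \<le> 2 * D * exp (- \<eta> * (r * \<phi> (\<mu> r t)))" if r: "0 < r" and t: "0 < t" for r t
  proof -
    define h where "h = (SUP s\<in>{0<..t}. s * p r s)"
    obtain B where B: "0 \<le> B" "\<And>t. p0 r t \<le> B" using p0_bounded[OF r] by blast
    have "s * p r s \<le> t * B" if "0 < s" "s \<le> t" for s
      using that B(2)[of s] p_nonneg[OF r that(1)] t by (intro mult_mono) auto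
    then have "bdd_above ((\<lambda>s. s * p r s) ` {0<..t})" by (intro bdd_aboveI[of _ "t * B"]) auto
    then have le_h: "s * p r s \<le> h" if "0 < s" "s \<le> t" for s
      unfolding h_def using that by (intro cSUP_upper) auto
    have "h \<le> h / 2 + D * exp (- \<eta> * (r * \<phi> (\<mu> r t)))"
      unfolding h_def
    proof (rule cSUP_least)
      fix u assume u: "u \<in> {0<..t}"
      have "u * p r u \<le> h / 2 + D * exp (- \<eta> * (r * \<phi> (\<mu> r u)))"
        using u by (intro step[OF r] le_h) auto
      also have "\<dots> \<le> h / 2 + D * exp (- \<eta> * (r * \<phi> (\<mu> r t)))"
        using u r D phi_mu_antimono[OF r, of u t] by (simp add: mult_left_mono)
      finally show "u * p r u \<le> (SUP s\<in>{0<..t}. s * p r s) / 2 + D * exp (- \<eta> * (r * \<phi> (\<mu> r t)))"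
        unfolding h_def .
    qed (use t in auto)
    with le_h[of t] t show ?thesis by simp
  qed
  with D show thesis by (intro that[of "2 * D" \<eta>]) auto
qed

text \<open>By \<open>density_upper_exp\<close>, \<open>s * p r s\<close> is bounded uniformly in
  \<open>r\<close> and \<open>s\<close>. Feeding this into \<open>density_upper\<close> with
  \<open>a = t / 2\<close> leaves only multiples of \<open>r * \<phi> (2 / t)\<close>.\<close>

lemma density_upper_jump:
  obtains A where "0 < A" "\<And>r t. 0 < r \<Longrightarrow> 0 < t \<Longrightarrow> t * p r t \<le> A * (r * \<phi> (1 / t))"
proof -
  obtain D \<eta> where D: "0 < D" "0 < \<eta>"
    and le: "\<And>r t. 0 < r \<Longrightarrow> 0 < t \<Longrightarrow> t * p r t \<le> D * exp (- \<eta> * (r * \<phi> (\<mu> r t)))"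
    using density_upper_exp by blast
  have "t * p r t \<le> (D + 1) * exp 1 * (k\<^sub>2 * 2 powr \<beta>\<^sub>2) * (r * \<phi> (1 / t))" if r: "0 < r" and t: "0 < t" for r t
  proof -
    have D_le: "s * p r s \<le> D" if s: "0 < s" for s
    proof -
      have "0 \<le> \<eta> * (r * \<phi> (\<mu> r s))" using D r phi_pos[OF mu_pos[OF r s]] by simp
      then have "D * exp (- \<eta> * (r * \<phi> (\<mu> r s))) \<le> D" using D by (intro mult_left_le) auto
      with le[OF r s] show ?thesis by linarith
    qed
    have "p r s \<le> 2 * D / t" if s: "0 < s" "t - t / 2 < s" "s < t" for s
    proof -
      have "t / 2 * p r s \<le> s * p r s" using s p_nonneg[OF r s(1)] by (intro mult_right_mono) auto
      with D_le[OF s(1)] have "t / 2 * p r s \<le> D" by linarith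
      then show ?thesis using t by (simp add: field_simps)
    qed
    then have "t * p r t \<le> r * (2 * D / t * (exp 1 * \<psi> (1 / (t / 2))) + K (t / 2) * cdf_S r t)"
      using D t by (intro density_upper[OF r t]) auto
    also have "\<dots> \<le> r * (D * (exp 1 * \<phi> (2 / t)) + exp 1 * \<phi> (2 / t) * 1)"
    proof (intro mult_left_mono[OF add_mono])
      have "2 / t * \<psi> (2 / t) \<le> \<phi> (2 / t)" using t by (intro laplace_exponent_deriv_le[OF levy]) auto
      then have "D * exp 1 * (2 / t * \<psi> (2 / t)) \<le> D * exp 1 * \<phi> (2 / t)"
        using D by (intro mult_left_mono) auto
      then show "2 * D / t * (exp 1 * \<psi> (1 / (t / 2))) \<le> D * (exp 1 * \<phi> (2 / t))" by (simp add: mult_ac)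
      have "K (t / 2) \<le> exp 1 * \<phi> (2 / t)" using K_le[of "t / 2"] t by simp
      then show "K (t / 2) * cdf_S r t \<le> exp 1 * \<phi> (2 / t) * 1"
        using phi_pos[of "2 / t"] t
        by (intro mult_mono[of "K (t / 2)" "exp 1 * \<phi> (2 / t)"]) (auto simp: cdf_le_1[OF r] cdf_nonneg[OF r])
    qed (use r in auto)
    also have "\<dots> = (D + 1) * exp 1 * r * \<phi> (2 / t)" by (simp add: algebra_simps)
    also have "\<dots> \<le> (D + 1) * exp 1 * r * (k\<^sub>2 * 2 powr \<beta>\<^sub>2 * \<phi> (1 / t))"
      using phi_scaling(2)[of "1 / t" 2] t r D by (intro mult_left_mono) auto
    finally show ?thesis by (simp add: mult_ac)
  qed
  with D params show thesis
    by (intro that[of "(D + 1) * exp 1 * (k\<^sub>2 * 2 powr \<beta>\<^sub>2)"]) auto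
qed

text \<open>Cut time into \<open>n\<close> pieces, \<open>n\<close> being
  \<open>t * \<mu> r t / \<delta>\<close> rounded up. Then \<open>\<psi> (n / t)\<close> is small
  against \<open>t / r\<close>, so \<open>cdf_markov\<close> gives each increment probability at
  least \<open>1 / 2\<close>, and \<open>cdf_power\<close> multiplies these.\<close>

lemma cdf_lower:
  obtains C where "0 < C" "\<And>r t. 0 < r \<Longrightarrow> 0 < t \<Longrightarrow> 1 / 2 * exp (- C * (t * \<mu> r t)) \<le> cdf_S r t"
proof -
  obtain C where C: "1 \<le> C" "\<And>l. 0 < l \<Longrightarrow> \<phi> l \<le> C * (l * \<psi> l)" using phi_le_psi by blast
  define \<epsilon> where "\<epsilon> = (1 - exp (- 1) :: real) / 2"
  have \<epsilon>: "0 < \<epsilon>" by (simp add: \<epsilon>_def)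
  \<comment> \<open>\<open>\<epsilon>\<close> is the threshold of \<open>cdf_markov\<close>;
    dividing by \<open>C\<close> pays for replacing \<open>\<phi>\<close> by
    \<open>\<psi>\<close>.\<close>
  obtain \<delta> where \<delta>: "0 < \<delta>" "\<delta> < 1" "\<And>l. 0 < l \<Longrightarrow> \<psi> (l / \<delta>) \<le> \<epsilon> / C * \<psi> l"
    using psi_decay[of "\<epsilon> / C"] C \<epsilon> by auto
  have "1 / 2 * exp (- (1 / \<delta>) * (t * \<mu> r t)) \<le> cdf_S r t" if r: "0 < r" and t: "0 < t" for r t
  proof -
    let ?m = "\<mu> r t"
    have m: "0 < ?m" by (rule mu_pos[OF r t])
    define n where "n = nat \<lceil>t * ?m / \<delta>\<rceil>"
    have pos: "0 < t * ?m / \<delta>" using t m \<delta> by simp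
    have n: "0 < n" "t * ?m / \<delta> \<le> real n" "real n \<le> t * ?m / \<delta> + 1"
    proof -
      show "t * ?m / \<delta> \<le> real n" unfolding n_def by (rule real_nat_ceiling_ge)
      with pos show "0 < n" by (cases n) auto
      show "real n \<le> t * ?m / \<delta> + 1" using pos unfolding n_def by linarith
    qed
    have "r / real n * \<phi> (1 / (t / real n)) \<le> r / real n * (C * (real n / t * \<psi> (real n / t)))"
      using C(2)[of "real n / t"] n t r by (intro mult_left_mono) auto
    also have "\<dots> = r * C / t * \<psi> (real n / t)" using n t r by simp
    also have "\<dots> \<le> r * C / t * \<psi> (?m / \<delta>)"
      using n t m \<delta> r C by (intro mult_left_mono laplace_exponent_deriv_antimono[OF levy]) (auto simp: field_simps)
    also have "\<dots> \<le> r * C / t * (\<epsilon> / C * (t / r))"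
      using \<delta>(3)[OF m] r t C by (intro mult_left_mono) (auto simp: psi_mu)
    also have "\<dots> = (1 - exp (- 1)) / 2" using r t C by (simp add: \<epsilon>_def)
    finally have half: "1 / 2 \<le> cdf_S (r / real n) (t / real n)"
      using n r t by (intro cdf_markov) auto
    \<comment> \<open>Rounding up gives only \<open>n - 1 \<le> t * ?m / \<delta>\<close>; the
      prefactor \<open>1 / 2\<close> of the claim accounts for the remaining increment.\<close>
    have "exp (- (1 / \<delta>) * (t * ?m)) \<le> exp (- real (n - 1))"
      using n by (simp add: of_nat_diff)
    also have "\<dots> = exp (- 1) ^ (n - 1)" by (simp flip: exp_of_nat_mult)
    also have "\<dots> \<le> (1 / 2) ^ (n - 1)"
    proof (intro power_mono)
      have "2 \<le> exp (1 :: real)" using exp_ge_add_one_self[of 1] by simp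
      then show "exp (- 1) \<le> (1 / 2 :: real)" by (simp add: exp_minus field_simps)
    qed simp
    finally have "1 / 2 * exp (- (1 / \<delta>) * (t * ?m)) \<le> (1 / 2) * (1 / 2) ^ (n - 1)" by simp
    also have "\<dots> = (1 / 2) ^ n" using n by (cases n) auto
    also have "\<dots> \<le> cdf_S (r / real n) (t / real n) ^ n" using half by (intro power_mono) auto
    also have "\<dots> \<le> cdf_S r t" by (rule cdf_power[OF r n(1)])
    finally show ?thesis .
  qed
  with \<delta> show thesis by (intro that[of "1 / \<delta>"]) auto
qed

text \<open>One bound for both regimes: when \<open>r * \<phi> (1 / t)\<close> is small the
  exponential is bounded below, and when it is large the prefactor is.\<close>

lemma density_lower_exp:
  obtains c C where "0 < c" "0 < C"
    "\<And>r t. 0 < r \<Longrightarrow> 0 < t \<Longrightarrow> c * (r * \<phi> (1 / t)) * exp (- C * (t * \<mu> r t)) \<le> t * p r t"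
proof -
  obtain c where c: "0 < c" "\<And>t. 0 < t \<Longrightarrow> c * \<phi> (1 / t) \<le> K t" using K_ge by blast
  obtain C where C: "0 < C" "\<And>r t. 0 < r \<Longrightarrow> 0 < t \<Longrightarrow> 1 / 2 * exp (- C * (t * \<mu> r t)) \<le> cdf_S r t"
    using cdf_lower by blast
  have "c / 2 * (r * \<phi> (1 / t)) * exp (- C * (t * \<mu> r t)) \<le> t * p r t" if r: "0 < r" and t: "0 < t" for r t
  proof -
    have "c / 2 * (r * \<phi> (1 / t)) * exp (- C * (t * \<mu> r t)) =
        r * (c * \<phi> (1 / t) * (1 / 2 * exp (- C * (t * \<mu> r t))))" by simp
    also have "\<dots> \<le> r * (K t * cdf_S r t)"
      using r mult_mono[OF c(2)[OF t] C(2)[OF r t] K_nonneg[OF t]] by (intro mult_left_mono) auto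
    also have "\<dots> \<le> t * p r t" by (rule density_lower[OF r t])
    finally show ?thesis .
  qed
  with c C show thesis by (intro that[of "c / 2" C]) auto
qed

text \<open>For \<open>y = t * \<mu> r t\<close> above 1, \<open>t_mu_le\<close> and upper scaling
  give \<open>y \<le> k\<^sub>2 * L * y powr \<beta>\<^sub>2\<close>, which bounds \<open>y\<close>
  since the power is below 1.\<close>

lemma t_mu_bounded:
  assumes r: "0 < r" and t: "0 < t" and L: "0 < L" "r * \<phi> (1 / t) \<le> L"
  shows "t * \<mu> r t \<le> max 1 ((k\<^sub>2 * L) powr (1 / (1 - \<beta>\<^sub>2)))"
proof (cases "t * \<mu> r t \<le> 1")
  case False
  define y where "y = t * \<mu> r t"
  have y: "1 < y" using False by (simp add: y_def)
  have "y \<le> r * \<phi> (y * (1 / t))" using t_mu_le[OF r t] t by (simp add: y_def)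
  also have "\<dots> \<le> r * (k\<^sub>2 * y powr \<beta>\<^sub>2 * \<phi> (1 / t))"
    using r t y by (intro mult_left_mono phi_scaling) auto
  also have "\<dots> = k\<^sub>2 * y powr \<beta>\<^sub>2 * (r * \<phi> (1 / t))" by simp
  also have "\<dots> \<le> k\<^sub>2 * y powr \<beta>\<^sub>2 * L" using L params by (intro mult_left_mono) auto
  finally have "y powr (1 - \<beta>\<^sub>2) \<le> k\<^sub>2 * L" using y by (simp add: powr_diff field_simps)
  then have "(y powr (1 - \<beta>\<^sub>2)) powr (1 / (1 - \<beta>\<^sub>2)) \<le> (k\<^sub>2 * L) powr (1 / (1 - \<beta>\<^sub>2))"
    using params by (intro powr_mono2) auto
  then show ?thesis using y params by (simp add: powr_powr y_def)
qed auto

end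

section \<open>Choice of constants and conclusion\<close>

theorem theorem4p4:
  fixes M :: "'a measure" and S :: "real \<Rightarrow> 'a \<Rightarrow> real"
    and \<nu> \<phi> :: "real \<Rightarrow> real" and p :: "real \<Rightarrow> real \<Rightarrow> real"
    and \<beta>\<^sub>1 \<beta>\<^sub>2 k\<^sub>1 k\<^sub>2 :: real
  assumes "driftless_subordinator M S \<nu>"
    and "\<phi> = laplace_exponent \<nu>"
    and "0 < \<beta>\<^sub>1" and "\<beta>\<^sub>1 < \<beta>\<^sub>2" and "\<beta>\<^sub>2 < 1" and "0 < k\<^sub>1" and "0 < k\<^sub>2"
    and "\<And>l \<kappa>. 0 < l \<Longrightarrow> 1 \<le> \<kappa> \<Longrightarrow>
           k\<^sub>1 * \<kappa> powr \<beta>\<^sub>1 \<le> \<phi> (\<kappa> * l) / \<phi> l \<and> \<phi> (\<kappa> * l) / \<phi> l \<le> k\<^sub>2 * \<kappa> powr \<beta>\<^sub>2"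
    and "antimono_on {0<..} (\<lambda>t. t * \<nu> t)"
    and "transition_density M S p"
  shows "\<forall>L>0. \<exists>c\<^sub>1\<ge>1. \<exists>c\<^sub>2\<ge>1. \<exists>c\<^sub>3\<ge>1.
    (\<forall>r>0. \<forall>t>0. r * \<phi> (1 / t) \<le> L \<longrightarrow>
       1 / (c\<^sub>1 * t) * (r * \<phi> (1 / t)) \<le> p r t \<and>
       p r t \<le> c\<^sub>1 / t * (r * \<phi> (1 / t))) \<and>
    (\<forall>r>0. \<forall>t>0. r * \<phi> (1 / t) \<ge> L \<longrightarrow>
       1 / (c\<^sub>2 * t) * exp (- c\<^sub>3 * t * deriv_inverse \<phi> (t / r)) \<le> p r t \<and>
       p r t \<le> c\<^sub>2 / t * exp (- (1 / c\<^sub>3) * t * deriv_inverse \<phi> (t / r)))"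
proof (intro allI impI)
  fix L :: real assume L: "0 < L"
  interpret X: driftless_subordinator M S \<nu> by (rule assms(1))
  interpret X: scaling_subordinator M S \<nu> \<beta>\<^sub>1 \<beta>\<^sub>2 k\<^sub>1 k\<^sub>2 p
  proof unfold_locales
    show "levy_density \<nu>" by (rule X.levy_density)
  qed (use assms in auto)
  note \<phi> = assms(2)
  obtain A where A: "0 < A" "\<And>r t. 0 < r \<Longrightarrow> 0 < t \<Longrightarrow> t * p r t \<le> A * (r * \<phi> (1 / t))"
    using X.density_upper_jump unfolding \<phi> by blast
  obtain D \<eta> where D: "0 < D" "0 < \<eta>"
    "\<And>r t. 0 < r \<Longrightarrow> 0 < t \<Longrightarrow> t * p r t \<le> D * exp (- \<eta> * (r * \<phi> (X.\<mu> r t)))"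
    using X.density_upper_exp unfolding \<phi> by blast
  obtain c C where c: "0 < c" "0 < C"
    "\<And>r t. 0 < r \<Longrightarrow> 0 < t \<Longrightarrow> c * (r * \<phi> (1 / t)) * exp (- C * (t * X.\<mu> r t)) \<le> t * p r t"
    using X.density_lower_exp unfolding \<phi> by blast
  \<comment> \<open>\<open>T\<close> bounds \<open>t * X.\<mu> r t\<close> in the first regime, so
    the exponential in the lower bound is at least \<open>exp (- C * T)\<close>. In the second
    regime \<open>L\<close> bounds the prefactor below, whence \<open>1 / (c * L)\<close>, and
    \<open>c\<^sub>3\<close> must dominate \<open>C\<close> for the lower bound and
    \<open>1 / \<eta>\<close> for the upper.\<close>
  define T where "T = max 1 ((k\<^sub>2 * L) powr (1 / (1 - \<beta>\<^sub>2)))"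
  define c\<^sub>1 where "c\<^sub>1 = max 1 (max A (exp (C * T) / c))"
  define c\<^sub>2 where "c\<^sub>2 = max 1 (max D (1 / (c * L)))"
  define c\<^sub>3 where "c\<^sub>3 = max 1 (max C (1 / \<eta>))"
  have c1: "1 \<le> c\<^sub>1" "A \<le> c\<^sub>1" "exp (C * T) / c \<le> c\<^sub>1" by (auto simp: c\<^sub>1_def)
  have c2: "1 \<le> c\<^sub>2" "D \<le> c\<^sub>2" "1 / (c * L) \<le> c\<^sub>2" by (auto simp: c\<^sub>2_def)
  have c3: "1 \<le> c\<^sub>3" "C \<le> c\<^sub>3" "1 / \<eta> \<le> c\<^sub>3" by (auto simp: c\<^sub>3_def)
  have "1 / (c\<^sub>1 * t) * (r * \<phi> (1 / t)) \<le> p r t \<and> p r t \<le> c\<^sub>1 / t * (r * \<phi> (1 / t))"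
    if r: "0 < r" and t: "0 < t" and small: "r * \<phi> (1 / t) \<le> L" for r t
  proof
    let ?x = "r * \<phi> (1 / t)"
    have x: "0 < ?x" using X.phi_pos[of "1 / t"] r t by (simp add: \<phi>)
    have "1 / c\<^sub>1 \<le> c * exp (- (C * T))"
      using c1 c(1) by (simp add: exp_minus field_simps)
    also have "\<dots> \<le> c * exp (- C * (t * X.\<mu> r t))"
      using X.t_mu_bounded[OF r t L] small c by (simp add: T_def \<phi>)
    finally have "1 / c\<^sub>1 * ?x \<le> c * exp (- C * (t * X.\<mu> r t)) * ?x"
      using x by (intro mult_right_mono) auto
    with c(3)[OF r t] have "1 / c\<^sub>1 * ?x \<le> t * p r t" by (simp add: mult_ac)
    then show "1 / (c\<^sub>1 * t) * ?x \<le> p r t" using t c1(1) by (simp add: field_simps)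
    have "A * ?x \<le> c\<^sub>1 * ?x" using c1 x by (intro mult_right_mono) auto
    with A(2)[OF r t] have "t * p r t \<le> c\<^sub>1 * ?x" by linarith
    then show "p r t \<le> c\<^sub>1 / t * ?x" using t by (simp add: field_simps)
  qed
  moreover have "1 / (c\<^sub>2 * t) * exp (- c\<^sub>3 * t * deriv_inverse \<phi> (t / r)) \<le> p r t \<and>
       p r t \<le> c\<^sub>2 / t * exp (- (1 / c\<^sub>3) * t * deriv_inverse \<phi> (t / r))"
    if r: "0 < r" and t: "0 < t" and large: "L \<le> r * \<phi> (1 / t)" for r t
  proof
    define m where "m = t * X.\<mu> r t"
    have m: "0 < m" using X.mu_pos[OF r t] t by (simp add: m_def)
    have "1 / c\<^sub>2 * exp (- c\<^sub>3 * m) \<le> c * L * exp (- C * m)"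
      using c2 c L c3 m by (intro mult_mono) (auto simp: field_simps)
    also have "\<dots> \<le> c * (r * \<phi> (1 / t)) * exp (- C * m)"
      using c large by (intro mult_right_mono mult_left_mono) auto
    also have "\<dots> \<le> t * p r t" using c(3)[OF r t] by (simp add: m_def)
    finally have "1 / c\<^sub>2 * exp (- c\<^sub>3 * m) \<le> t * p r t" .
    then show "1 / (c\<^sub>2 * t) * exp (- c\<^sub>3 * t * deriv_inverse \<phi> (t / r)) \<le> p r t"
      using t c2(1) by (simp add: \<phi> m_def field_simps)
    have "1 / c\<^sub>3 * m \<le> \<eta> * (r * \<phi> (X.\<mu> r t))"
    proof (rule mult_mono)
      show "1 / c\<^sub>3 \<le> \<eta>" using c3 D by (simp add: field_simps)
      show "m \<le> r * \<phi> (X.\<mu> r t)" using X.t_mu_le[OF r t] by (simp add: m_def \<phi>)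
    qed (use D m in auto)
    then have "D * exp (- \<eta> * (r * \<phi> (X.\<mu> r t))) \<le> c\<^sub>2 * exp (- (1 / c\<^sub>3) * m)"
      using c2 D by (intro mult_mono) auto
    with D(3)[OF r t] have "t * p r t \<le> c\<^sub>2 * exp (- (1 / c\<^sub>3) * m)" by linarith
    then show "p r t \<le> c\<^sub>2 / t * exp (- (1 / c\<^sub>3) * t * deriv_inverse \<phi> (t / r))"
      using t by (simp add: \<phi> m_def field_simps)
  qed
  ultimately show "\<exists>c\<^sub>1\<ge>1. \<exists>c\<^sub>2\<ge>1. \<exists>c\<^sub>3\<ge>1.
    (\<forall>r>0. \<forall>t>0. r * \<phi> (1 / t) \<le> L \<longrightarrow>
       1 / (c\<^sub>1 * t) * (r * \<phi> (1 / t)) \<le> p r t \<and>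
       p r t \<le> c\<^sub>1 / t * (r * \<phi> (1 / t))) \<and>
    (\<forall>r>0. \<forall>t>0. r * \<phi> (1 / t) \<ge> L \<longrightarrow>
       1 / (c\<^sub>2 * t) * exp (- c\<^sub>3 * t * deriv_inverse \<phi> (t / r)) \<le> p r t \<and>
       p r t \<le> c\<^sub>2 / t * exp (- (1 / c\<^sub>3) * t * deriv_inverse \<phi> (t / r)))"
    using c1(1) c2(1) c3(1) by blast
qed

end
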